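(* Let $L$ be any fixed graph with at least one edge, and let $k=k(n)$. If $k=o(n^{v(L)})$, then $$\lim_{n\to\infty}\frac{\log M_{L}(n,k)}{\binom{n}{2}}=\frac{1}{\chi(L)-1}.$$ If $k=cn^{v(L)}$ for some constant $c>0$, then $$\lim_{n\to\infty}\frac{\log M_{L}(n,k)}{\binom{n}{2}}\leq \frac{1}{\chi(L)-1}-\frac{2c}{e(L)}.$$
   Context: Logarithms are base 2. $v(L)$, $e(L)$, $\chi(L)$ denote the number of vertices, number of edges and chromatic number of $L$. For graphs $G,G'$ on the same vertex set $[n]$, their symmetric difference $G\oplus G'$ is the graph on $[n]$ whose edge set consists of all edges belonging to exactly one of $G,G'$. $M_{L}(n,k)$ denotes the largest cardinality of a family $\mathcal{G}$ of graphs on vertex set $[n]$ such that for any two distinct members $G,G'\in\mathcal{G}$, the graph $G\oplus G'$ contains at least $k$ copies of $L$ (subgraphs isomorphic to $L$).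
   Formalization: In the first part k(n) ≥ 1 is assumed, since the claim fails for k = 0 when χ(L) ≥ 3; in the second part 2c/e(L) ≤ 1/(χ(L)−1) is assumed, since otherwise the right side is negative while log M ≥ 0; "lim ≤" is read as limsup ≤. *)

theory Defs
  imports Complex_Main "HOL-Library.Landau_Symbols" "HOL-Library.Extended_Real"
begin

definition graph_on :: "'a set \<Rightarrow> 'a set set \<Rightarrow> bool" where
  "graph_on V E \<longleftrightarrow> finite V \<and> (\<forall>e\<in>E. e \<subseteq> V \<and> card e = 2)"

text \<open>All possible edges on the vertex set [n] = {0..<n}; a graph on [n] is a subset of it.\<close>
definition all_edges :: "nat \<Rightarrow> nat set set" where
  "all_edges n = {e. e \<subseteq> {0..<n} \<and> card e = 2}"

definition symdiff :: "nat set set \<Rightarrow> nat set set \<Rightarrow> nat set set" where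
  "symdiff G G' = (G - G') \<union> (G' - G)"

definition copies :: "'a set \<Rightarrow> 'a set set \<Rightarrow> nat \<Rightarrow> nat set set \<Rightarrow> (nat set \<times> nat set set) set" where
  "copies VL EL n G = {(f ` VL, (\<lambda>e. f ` e) ` EL) | f.
      inj_on f VL \<and> f ` VL \<subseteq> {0..<n} \<and> (\<lambda>e. f ` e) ` EL \<subseteq> G}"

definition num_copies :: "'a set \<Rightarrow> 'a set set \<Rightarrow> nat \<Rightarrow> nat set set \<Rightarrow> nat" where
  "num_copies VL EL n G = card (copies VL EL n G)"

definition chromatic_number :: "'a set \<Rightarrow> 'a set set \<Rightarrow> nat" where
  "chromatic_number V E = (LEAST k. \<exists>col :: 'a \<Rightarrow> nat. col ` V \<subseteq> {..<k} \<and>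
      (\<forall>e\<in>E. \<forall>x\<in>e. \<forall>y\<in>e. x \<noteq> y \<longrightarrow> col x \<noteq> col y))"

definition M_L :: "'a set \<Rightarrow> 'a set set \<Rightarrow> nat \<Rightarrow> real \<Rightarrow> nat" where
  "M_L VL EL n k = Max {card \<G> | \<G>. \<G> \<subseteq> Pow (all_edges n) \<and>
      (\<forall>G\<in>\<G>. \<forall>G'\<in>\<G>. G \<noteq> G' \<longrightarrow> real (num_copies VL EL n (symdiff G G')) \<ge> k)}"

end

theory Submission
  imports Defs "HOL-Analysis.Convex" "HOL-Library.FuncSet"
begin

text \<open>
  Write \<open>r = \<chi>(L) - 1\<close>. For the upper bounds, if a graph \<open>H\<close> on \<open>[n]\<close> has fewer than \<open>k\<close> copies of \<open>L\<close>,
  then two members of a code cannot agree outside \<open>H\<close>, so the code has at most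
  \<open>2 ^ ((n choose 2) - e(H))\<close> members. For \<open>k \<ge> 1\<close> take for \<open>H\<close> the \<open>r\<close>-partite Turan graph. For
  \<open>k = c n ^ v(L)\<close> add to it the right number of edges inside the parts, choosing those that are
  charged with the fewest copies of \<open>L\<close>.

  The lower bound is the Gilbert-Varshamov bound: a maximal code has at least
  \<open>2 ^ (n choose 2) / |B|\<close> members, where \<open>B\<close> consists of the graphs with fewer than \<open>k\<close> copies of \<open>L\<close>.
  By the Frieze-Kannan weak regularity lemma, every graph in \<open>B\<close> is contained, up to few edges, in one
  of \<open>2 ^ O(n)\<close> step graphs, and by the counting lemma such a step graph has few homomorphic copies
  of \<open>L\<close>; supersaturation then bounds its edge density by \<open>1 - 1/r + o(1)\<close>.
  Hence \<open>|B| \<le> 2 ^ ((1 - 1/r + o(1)) (n choose 2))\<close>.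
\<close>

section \<open>Weak regularity\<close>

text \<open>Weak regularity suffices because the step graphs only have to number 2 ^ o(n^2): each is
  a labelling of the vertices by boundedly many labels together with a relation on the labels.
  Copies of L need not be induced, so the argument is one-sided: only upper bounds on "step average
  minus graph" occur, and L may be enlarged to the complete multipartite graph on its colour
  classes. Homomorphisms are counted instead of copies since they behave well under averaging and
  under cloning a vertex; only O(n ^ (v(L) - 1)) of them are not injective.

  The constant 2c / e(L) measures how many inner edges may be added to the Turan graph. If the
  complete graph has N copies of L, any share of the inner edges below c n ^ v(L) / N is safe, and
  this must reach 2rc / e(L). Hence N \<le> e(L) n ^ v(L) / (2r) is needed. The trivial N \<le> n ^
  v(L) is enough once e(L) \<ge> 2r, which can fail only if e(L) equals \<chi>(L) choose 2; such an
  L has a nontrivial automorphism, which halves the count.\<close>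

definition cond_avg :: "'b set \<Rightarrow> ('b \<Rightarrow> 'c) \<Rightarrow> ('b \<Rightarrow> real) \<Rightarrow> 'b \<Rightarrow> real" where
  "cond_avg \<Omega> P g z = (\<Sum>w\<in>{w\<in>\<Omega>. P w = P z}. g w) / real (card {w\<in>\<Omega>. P w = P z})"

lemma cond_avg_cong: "P z = P w \<Longrightarrow> cond_avg \<Omega> P g z = cond_avg \<Omega> P g w"
  by (simp add: cond_avg_def)

lemma cond_avg_nonneg: "(\<And>w. w \<in> \<Omega> \<Longrightarrow> 0 \<le> g w) \<Longrightarrow> 0 \<le> cond_avg \<Omega> P g z"
  by (auto simp: cond_avg_def intro!: divide_nonneg_nonneg sum_nonneg)

lemma cond_avg_le_1:
  assumes "\<And>w. w \<in> \<Omega> \<Longrightarrow> g w \<le> 1"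
  shows "cond_avg \<Omega> P g z \<le> 1"
proof -
  have "(\<Sum>w\<in>{w\<in>\<Omega>. P w = P z}. g w) \<le> real (card {w\<in>\<Omega>. P w = P z}) * 1"
    by (rule sum_bounded_above) (use assms in auto)
  \<comment> \<open>Over an empty fibre the average is 0 / 0 = 0.\<close>
  then show ?thesis
    by (cases "card {w\<in>\<Omega>. P w = P z} = 0") (auto simp: cond_avg_def divide_simps)
qed

text \<open>A factor \<open>h\<close> that is constant on a fibre can be pulled out of the fibre
  sum; what remains is the mean times the size of the fibre, which is the fibre sum of
  \<open>g\<close>. This is the projection property of conditional expectation.\<close>

lemma sum_cond_avg_mult:
  assumes fin: "finite \<Omega>" and meas: "\<And>z w. z \<in> \<Omega> \<Longrightarrow> w \<in> \<Omega> \<Longrightarrow> P z = P w \<Longrightarrow> h z = h w"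
  shows "(\<Sum>z\<in>\<Omega>. cond_avg \<Omega> P g z * h z) = (\<Sum>z\<in>\<Omega>. g z * h z)"
proof -
  have fibre: "(\<Sum>z\<in>{z\<in>\<Omega>. P z = c}. cond_avg \<Omega> P g z * h z) = (\<Sum>z\<in>{z\<in>\<Omega>. P z = c}. g z * h z)"
    if c: "c \<in> P ` \<Omega>" for c
  proof -
    obtain z0 where z0: "z0 \<in> \<Omega>" "P z0 = c" using c by auto
    let ?F = "{z\<in>\<Omega>. P z = c}"
    have card: "real (card ?F) \<noteq> 0" using fin z0 by auto
    have h: "h z = h z0" if "z \<in> ?F" for z by (rule meas) (use that z0 in auto)
    have "(\<Sum>z\<in>?F. cond_avg \<Omega> P g z * h z) = (\<Sum>z\<in>?F. ((\<Sum>w\<in>?F. g w) / real (card ?F)) * h z0)"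
      by (rule sum.cong) (auto simp: cond_avg_def h)
    also have "\<dots> = (\<Sum>w\<in>?F. g w) * h z0" using card by simp
    also have "\<dots> = (\<Sum>z\<in>?F. g z * h z)"
      unfolding sum_distrib_right by (rule sum.cong) (auto simp: h)
    finally show ?thesis .
  qed
  show ?thesis
    unfolding sum.image_gen[OF fin, of "\<lambda>z. cond_avg \<Omega> P g z * h z" P]
      sum.image_gen[OF fin, of "\<lambda>z. g z * h z" P]
    by (rule sum.cong[OF refl fibre])
qed

lemma sum_cond_avg_subset:
  assumes fin: "finite \<Omega>" and "B \<subseteq> \<Omega>"
    and meas: "\<And>z w. z \<in> \<Omega> \<Longrightarrow> w \<in> \<Omega> \<Longrightarrow> P z = P w \<Longrightarrow> z \<in> B \<longleftrightarrow> w \<in> B"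
  shows "(\<Sum>z\<in>B. cond_avg \<Omega> P g z) = (\<Sum>z\<in>B. g z)"
proof -
  have *: "(\<Sum>z\<in>B. f z) = (\<Sum>z\<in>\<Omega>. f z * of_bool (z \<in> B))" for f :: "_ \<Rightarrow> real"
    using fin \<open>B \<subseteq> \<Omega>\<close> by (simp add: of_bool_def if_distrib sum.If_cases Int_absorb1 cong: if_cong)
  show ?thesis
    unfolding * by (rule sum_cond_avg_mult[OF fin], subst meas) auto
qed

lemma energy_increment:
  assumes fin: "finite \<Omega>" and "B \<subseteq> \<Omega>"
    and ref: "\<And>z w. P' z = P' w \<Longrightarrow> P z = P w"
    and meas: "\<And>z w. z \<in> \<Omega> \<Longrightarrow> w \<in> \<Omega> \<Longrightarrow> P' z = P' w \<Longrightarrow> z \<in> B \<longleftrightarrow> w \<in> B"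
    and irregular: "(\<Sum>z\<in>B. cond_avg \<Omega> P g z - g z) > \<delta> * real (card \<Omega>)" and "\<delta> \<ge> 0"
  shows "(\<Sum>z\<in>\<Omega>. (cond_avg \<Omega> P' g z)\<^sup>2) \<ge> (\<Sum>z\<in>\<Omega>. (cond_avg \<Omega> P g z)\<^sup>2) + \<delta>\<^sup>2 * real (card \<Omega>)"
proof -
  define f where "f = cond_avg \<Omega> P g"
  define f' where "f' = cond_avg \<Omega> P' g"
  have "(\<Sum>z\<in>\<Omega>. f' z * f z) = (\<Sum>z\<in>\<Omega>. g z * f z)"
    unfolding f'_def unfolding f_def by (rule sum_cond_avg_mult[OF fin]) (rule cond_avg_cong, rule ref)
  also have "\<dots> = (\<Sum>z\<in>\<Omega>. f z * f z)"
    unfolding f_def by (rule sum_cond_avg_mult[OF fin, symmetric]) (auto intro: cond_avg_cong)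
  finally have cross: "(\<Sum>z\<in>\<Omega>. f' z * f z) = (\<Sum>z\<in>\<Omega>. (f z)\<^sup>2)" by (simp add: power2_eq_square)
  have "(\<Sum>z\<in>\<Omega>. (f z - f' z)\<^sup>2) = (\<Sum>z\<in>\<Omega>. (f z)\<^sup>2) + (\<Sum>z\<in>\<Omega>. (f' z)\<^sup>2) - 2 * (\<Sum>z\<in>\<Omega>. f' z * f z)"
    unfolding sum_distrib_left sum.distrib[symmetric] sum_subtractf[symmetric]
    by (rule sum.cong) (auto simp: power2_eq_square algebra_simps)
  then have pyth: "(\<Sum>z\<in>\<Omega>. (f z - f' z)\<^sup>2) = (\<Sum>z\<in>\<Omega>. (f' z)\<^sup>2) - (\<Sum>z\<in>\<Omega>. (f z)\<^sup>2)"
    using cross by simp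
  have "(\<Sum>z\<in>B. f' z) = (\<Sum>z\<in>B. g z)"
    unfolding f'_def by (rule sum_cond_avg_subset[OF fin \<open>B \<subseteq> \<Omega>\<close>]) (rule meas)
  then have big: "(\<Sum>z\<in>B. f z - f' z) > \<delta> * real (card \<Omega>)"
    using irregular by (simp add: f_def sum_subtractf)
  then have pos: "card \<Omega> > 0"
    using \<open>B \<subseteq> \<Omega>\<close> fin by (cases "\<Omega> = {}") auto
  have "(\<delta> * real (card \<Omega>))\<^sup>2 \<le> (\<Sum>z\<in>B. f z - f' z)\<^sup>2"
    using big \<open>\<delta> \<ge> 0\<close> by (intro power_mono) auto
  also have "\<dots> \<le> (\<Sum>z\<in>B. (f z - f' z)\<^sup>2) * card B" by (rule sum_squared_le_sum_of_squares)
  also have "\<dots> \<le> (\<Sum>z\<in>\<Omega>. (f z - f' z)\<^sup>2) * card \<Omega>"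
    using fin \<open>B \<subseteq> \<Omega>\<close> by (intro mult_mono sum_mono2 sum_nonneg) (auto intro: card_mono)
  finally have "(\<delta>\<^sup>2 * real (card \<Omega>)) * card \<Omega> \<le> (\<Sum>z\<in>\<Omega>. (f z - f' z)\<^sup>2) * card \<Omega>"
    by (simp add: power2_eq_square mult_ac)
  then have "\<delta>\<^sup>2 * real (card \<Omega>) \<le> (\<Sum>z\<in>\<Omega>. (f z - f' z)\<^sup>2)" using pos by simp
  then show ?thesis using pyth by (simp add: f_def f'_def)
qed

abbreviation step_avg :: "nat set \<Rightarrow> (nat \<Rightarrow> nat) \<Rightarrow> (nat \<times> nat \<Rightarrow> real) \<Rightarrow> nat \<times> nat \<Rightarrow> real" where
  "step_avg V p g \<equiv> cond_avg (V \<times> V) (map_prod p p) g"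

lemma weak_regularity:
  fixes g :: "nat \<times> nat \<Rightarrow> real"
  assumes "finite V" and g: "\<And>z. 0 \<le> g z" "\<And>z. g z \<le> 1" and "\<delta> > 0" and i: "real i * \<delta>\<^sup>2 > 1"
  shows "\<exists>p. p ` V \<subseteq> {..<4 ^ i} \<and>
    (\<forall>A\<subseteq>V. \<forall>B\<subseteq>V. (\<Sum>z\<in>A \<times> B. step_avg V p g z - g z) \<le> \<delta> * real (card V) ^ 2)"
proof (rule ccontr)
  assume neg: "\<not> ?thesis"
  have fin: "finite (V \<times> V)" using assms by simp
  have "\<exists>p. p ` V \<subseteq> {..<4 ^ j} \<and>
      (\<Sum>z\<in>V \<times> V. (step_avg V p g z)\<^sup>2) \<ge> real j * \<delta>\<^sup>2 * real (card (V \<times> V))" if "j \<le> i" for j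
    using that
  proof (induction j)
    case 0
    show ?case by (intro exI[of _ "\<lambda>_. 0"]) (auto intro: sum_nonneg)
  next
    case (Suc j)
    then obtain p where p: "p ` V \<subseteq> {..<4 ^ j}"
      "(\<Sum>z\<in>V \<times> V. (step_avg V p g z)\<^sup>2) \<ge> real j * \<delta>\<^sup>2 * real (card (V \<times> V))" by auto
    have "{..<4 ^ j} \<subseteq> {..<4 ^ i :: nat}" using Suc.prems by (simp add: power_increasing)
    then have "p ` V \<subseteq> {..<4 ^ i}" using subset_trans[OF p(1)] by blast
    then obtain A B where AB: "A \<subseteq> V" "B \<subseteq> V"
      "(\<Sum>z\<in>A \<times> B. step_avg V p g z - g z) > \<delta> * real (card V) ^ 2"
      using neg by (meson not_le)
    then have AB3: "(\<Sum>z\<in>A \<times> B. step_avg V p g z - g z) > \<delta> * real (card (V \<times> V))"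
      by (simp add: card_cartesian_product power2_eq_square)
    \<comment> \<open>A new base-4 digit records membership in \<open>A\<close> and in
      \<open>B\<close>, which is the source of the bound \<open>4 ^ i\<close>.\<close>
    define p' where "p' x = 4 * p x + 2 * of_bool (x \<in> A) + of_bool (x \<in> B)" for x
    have p'_eq: "p x = p y \<and> (x \<in> A \<longleftrightarrow> y \<in> A) \<and> (x \<in> B \<longleftrightarrow> y \<in> B)" if "p' x = p' y" for x y
      using that unfolding p'_def of_bool_def by (auto split: if_splits; presburger)
    have "(\<Sum>z\<in>V \<times> V. (step_avg V p' g z)\<^sup>2) \<ge> (\<Sum>z\<in>V \<times> V. (step_avg V p g z)\<^sup>2) + \<delta>\<^sup>2 * real (card (V \<times> V))"
      by (rule energy_increment[OF fin _ _ _ AB3]) (use AB(1,2) \<open>\<delta> > 0\<close> in \<open>auto dest: p'_eq\<close>)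
    moreover have "p' ` V \<subseteq> {..<4 ^ Suc j}"
    proof
      fix y assume "y \<in> p' ` V"
      then obtain x where x: "x \<in> V" "y = p' x" by auto
      have "p x < 4 ^ j" using p(1) x by auto
      then show "y \<in> {..<4 ^ Suc j}" unfolding x p'_def by (auto simp: of_bool_def)
    qed
    ultimately show ?case using p(2) by (intro exI[of _ p']) (auto simp: algebra_simps)
  qed
  from this[of i] obtain p where p: "p ` V \<subseteq> {..<4 ^ i}"
      "(\<Sum>z\<in>V \<times> V. (step_avg V p g z)\<^sup>2) \<ge> real i * \<delta>\<^sup>2 * real (card (V \<times> V))" by auto
  have "V \<noteq> {}"
  proof
    assume "V = {}"
    then show False using neg by auto
  qed
  have "(\<Sum>z\<in>V \<times> V. (step_avg V p g z)\<^sup>2) \<le> real (card (V \<times> V)) * 1"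
    by (rule sum_bounded_above) (auto intro!: power_le_one cond_avg_nonneg cond_avg_le_1 g)
  also have "\<dots> < real i * \<delta>\<^sup>2 * real (card (V \<times> V))"
    using i \<open>V \<noteq> {}\<close> assms(1) by (simp add: card_gt_0_iff)
  finally show False using p(2) by simp
qed

lemma step_avg_commute:
  assumes "\<And>x y. g (x, y) = g (y, x)"
  shows "step_avg V p g (x, y) = step_avg V p g (y, x)"
proof -
  have im: "{w \<in> V \<times> V. map_prod p p w = map_prod p p (x, y)} =
    prod.swap ` {w \<in> V \<times> V. map_prod p p w = map_prod p p (y, x)}" by (force simp: image_iff)
  have inj: "inj_on prod.swap X" for X :: "(nat \<times> nat) set" by (auto simp: inj_on_def)
  show ?thesis
    unfolding cond_avg_def im using assms
    by (subst sum.reindex[OF inj], subst card_image[OF inj]) (auto intro!: arg_cong2[of _ _ _ _ "(/)"] sum.cong)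
qed

section \<open>The counting lemma\<close>

lemma sum_PiE_insert:
  assumes "u \<notin> U"
  shows "(\<Sum>\<phi>\<in>insert u U \<rightarrow>\<^sub>E V. F \<phi>) = (\<Sum>x\<in>V. \<Sum>\<phi>\<in>U \<rightarrow>\<^sub>E V. F (\<phi>(u := x)))"
proof -
  have "(\<Sum>\<phi>\<in>insert u U \<rightarrow>\<^sub>E V. F \<phi>) = (\<Sum>(x, \<phi>)\<in>V \<times> (U \<rightarrow>\<^sub>E V). F (\<phi>(u := x)))"
    unfolding PiE_insert_eq
    by (subst sum.reindex) (use inj_combinator[OF assms, of "\<lambda>_. V"] in \<open>auto simp: case_prod_unfold\<close>)
  then show ?thesis by (simp add: sum.cartesian_product)
qed

lemma sum_weighted_le_cut:
  fixes d :: "nat \<times> nat \<Rightarrow> real"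
  assumes fin: "finite V" and cut: "\<And>A B. A \<subseteq> V \<Longrightarrow> B \<subseteq> V \<Longrightarrow> (\<Sum>z\<in>A \<times> B. d z) \<le> K"
    and a: "\<And>x. 0 \<le> a x" "\<And>x. a x \<le> 1" and b: "\<And>x. 0 \<le> b x" "\<And>x. b x \<le> 1"
  shows "(\<Sum>x\<in>V. \<Sum>y\<in>V. d (x, y) * a x * b y) \<le> K"
proof -
  \<comment> \<open>A linear functional on the cube is maximal at a vertex.\<close>
  have round: "(\<Sum>x\<in>V. F x * c x) \<le> (\<Sum>x\<in>{x\<in>V. F x \<ge> 0}. F x)"
    if "\<And>x. 0 \<le> c x" "\<And>x. c x \<le> 1" for F c :: "nat \<Rightarrow> real"
  proof -
    have "(\<Sum>x\<in>V. F x * c x) \<le> (\<Sum>x\<in>V. if F x \<ge> 0 then F x else 0)"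
    proof (rule sum_mono)
      fix x show "F x * c x \<le> (if F x \<ge> 0 then F x else 0)"
        using that[of x] by (auto simp: mult_left_le mult_nonpos_nonneg not_le less_imp_le)
    qed
    then show ?thesis using fin by (simp add: sum.inter_filter)
  qed
  define A where "A = {x\<in>V. (\<Sum>y\<in>V. d (x, y) * b y) \<ge> 0}"
  define B where "B = {y\<in>V. (\<Sum>x\<in>A. d (x, y)) \<ge> 0}"
  have "(\<Sum>x\<in>V. \<Sum>y\<in>V. d (x, y) * a x * b y) = (\<Sum>x\<in>V. (\<Sum>y\<in>V. d (x, y) * b y) * a x)"
    unfolding sum_distrib_right by (intro sum.cong) (auto simp: mult_ac)
  also have "\<dots> \<le> (\<Sum>x\<in>A. \<Sum>y\<in>V. d (x, y) * b y)"
    unfolding A_def by (rule round[OF a])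
  also have "\<dots> = (\<Sum>y\<in>V. (\<Sum>x\<in>A. d (x, y)) * b y)"
    by (subst sum.swap) (simp add: sum_distrib_right)
  also have "\<dots> \<le> (\<Sum>y\<in>B. \<Sum>x\<in>A. d (x, y))"
    unfolding B_def by (rule round[OF b])
  also have "\<dots> = (\<Sum>z\<in>A \<times> B. d z)"
    by (subst sum.swap) (simp add: sum.cartesian_product)
  also have "\<dots> \<le> K" by (rule cut) (auto simp: A_def B_def)
  finally show ?thesis .
qed

text \<open>For a 0/1-valued symmetric \<open>f\<close> this counts homomorphisms, not necessarily
  injective. \<open>D\<close> consists of ordered pairs and is meant to contain each edge in one
  direction only.\<close>

definition hom_weight :: "nat set \<Rightarrow> 'a set \<Rightarrow> ('a \<times> 'a) set \<Rightarrow> (nat \<times> nat \<Rightarrow> real) \<Rightarrow> real" where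
  "hom_weight V U D f = (\<Sum>\<phi>\<in>U \<rightarrow>\<^sub>E V. \<Prod>e\<in>D. f (map_prod \<phi> \<phi> e))"

text \<open>Fix the images of all vertices except \<open>u\<close> and \<open>w\<close>. No pair in
  \<open>D\<close> joins \<open>u\<close> and \<open>w\<close>, so the remaining product splits into
  a factor depending on the image of \<open>u\<close> and one depending on the image of
  \<open>w\<close>, both in [0, 1], and the cut bound applies to each of the
  \<open>card V ^ (card U - 2)\<close> fixings.\<close>

lemma edge_replacement:
  fixes d :: "nat \<times> nat \<Rightarrow> real" and W :: "'a \<times> 'a \<Rightarrow> nat \<times> nat \<Rightarrow> real"
  assumes fin: "finite V" "finite U" "finite D"
    and cut: "\<And>A B. A \<subseteq> V \<Longrightarrow> B \<subseteq> V \<Longrightarrow> (\<Sum>z\<in>A \<times> B. d z) \<le> \<delta> * real (card V) ^ 2"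
    and W: "\<And>e z. 0 \<le> W e z" "\<And>e z. W e z \<le> 1"
    and uw: "u \<in> U" "w \<in> U" "u \<noteq> w" and D: "(u, w) \<notin> D" "(w, u) \<notin> D" "(u, u) \<notin> D" "(w, w) \<notin> D"
  shows "(\<Sum>\<phi>\<in>U \<rightarrow>\<^sub>E V. d (\<phi> u, \<phi> w) * (\<Prod>e\<in>D. W e (map_prod \<phi> \<phi> e))) \<le> \<delta> * real (card V) ^ card U"
proof -
  define U0 where "U0 = U - {u, w}"
  have U: "U = insert u (insert w U0)" "u \<notin> insert w U0" "w \<notin> U0" using uw by (auto simp: U0_def)
  have "finite U0" using fin by (simp add: U0_def)
  then have cU: "card U = card U0 + 2" unfolding U(1) using U(2,3) by simp
  define Du where "Du = {e\<in>D. fst e = u \<or> snd e = u}"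
  let ?p = "\<lambda>\<psi> x y. \<psi>(w := y, u := x)"
  \<comment> \<open>The 0 is a dummy image for \<open>w\<close>, which no pair in \<open>Du\<close>
    contains; likewise for \<open>u\<close> in \<open>b\<close>. Pairs meeting neither
    \<open>u\<close> nor \<open>w\<close> are put into \<open>b\<close>.\<close>
  define a where "a \<psi> x = (\<Prod>e\<in>Du. W e (map_prod (?p \<psi> x 0) (?p \<psi> x 0) e))" for \<psi> x
  define b where "b \<psi> y = (\<Prod>e\<in>D - Du. W e (map_prod (?p \<psi> 0 y) (?p \<psi> 0 y) e))" for \<psi> y
  have split: "(\<Prod>e\<in>D. W e (map_prod (?p \<psi> x y) (?p \<psi> x y) e)) = a \<psi> x * b \<psi> y" for \<psi> x y
  proof -
    have "(\<Prod>e\<in>D. W e (map_prod (?p \<psi> x y) (?p \<psi> x y) e)) =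
      (\<Prod>e\<in>D - Du. W e (map_prod (?p \<psi> x y) (?p \<psi> x y) e)) * (\<Prod>e\<in>Du. W e (map_prod (?p \<psi> x y) (?p \<psi> x y) e))"
      by (rule prod.subset_diff) (use fin in \<open>auto simp: Du_def\<close>)
    also have "(\<Prod>e\<in>D - Du. W e (map_prod (?p \<psi> x y) (?p \<psi> x y) e)) = b \<psi> y"
      unfolding b_def by (rule prod.cong) (auto simp: Du_def)
    also have "(\<Prod>e\<in>Du. W e (map_prod (?p \<psi> x y) (?p \<psi> x y) e)) = a \<psi> x"
      unfolding a_def by (rule prod.cong) (use D uw in \<open>auto simp: Du_def\<close>)
    finally show ?thesis by (simp only: mult.commute)
  qed
  have ab: "0 \<le> a \<psi> x" "a \<psi> x \<le> 1" "0 \<le> b \<psi> x" "b \<psi> x \<le> 1" for \<psi> x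
    unfolding a_def b_def by (intro prod_nonneg prod_le_1 conjI W ballI)+
  have "(\<Sum>\<phi>\<in>U \<rightarrow>\<^sub>E V. d (\<phi> u, \<phi> w) * (\<Prod>e\<in>D. W e (map_prod \<phi> \<phi> e))) =
    (\<Sum>x\<in>V. \<Sum>y\<in>V. \<Sum>\<psi>\<in>U0 \<rightarrow>\<^sub>E V. d (x, y) * (a \<psi> x * b \<psi> y))"
    unfolding U(1) sum_PiE_insert[OF U(2)] sum_PiE_insert[OF U(3)] split using uw by simp
  also have "\<dots> = (\<Sum>\<psi>\<in>U0 \<rightarrow>\<^sub>E V. \<Sum>x\<in>V. \<Sum>y\<in>V. d (x, y) * a \<psi> x * b \<psi> y)"
    unfolding mult.assoc
    by (subst sum.swap[of _ V "U0 \<rightarrow>\<^sub>E V"], rule sum.cong[OF refl], rule sum.swap)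
  also have "\<dots> \<le> (\<Sum>\<psi>\<in>U0 \<rightarrow>\<^sub>E V. \<delta> * real (card V) ^ 2)"
    by (intro sum_mono sum_weighted_le_cut[OF fin(1) cut] ab)
  also have "\<dots> = \<delta> * real (card V) ^ card U"
    using \<open>finite U0\<close> by (simp add: cU card_PiE power_add power2_eq_square)
  finally show ?thesis .
qed

text \<open>Telescoping: \<open>g\<close> is exchanged for \<open>f\<close> on one edge at a time,
  and each exchange costs at most \<delta> \<open>card V ^ card U\<close> by
  \<open>edge_replacement\<close>. The set \<open>A\<close> in the proof holds the edges already
  exchanged.\<close>

lemma hom_weight_counting:
  assumes fin: "finite V" "finite U" "finite D"
    and cut: "\<And>A B. A \<subseteq> V \<Longrightarrow> B \<subseteq> V \<Longrightarrow> (\<Sum>z\<in>A \<times> B. f z - g z) \<le> \<delta> * real (card V) ^ 2"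
    and f: "\<And>z. 0 \<le> f z" "\<And>z. f z \<le> 1" and g: "\<And>z. 0 \<le> g z" "\<And>z. g z \<le> 1"
    and D: "D \<subseteq> U \<times> U" "\<And>u w. (u, w) \<in> D \<Longrightarrow> (w, u) \<notin> D"
  shows "hom_weight V U D f \<le> hom_weight V U D g + real (card D) * \<delta> * real (card V) ^ card U"
proof -
  let ?h = "\<lambda>A. \<Sum>\<phi>\<in>U \<rightarrow>\<^sub>E V. \<Prod>e\<in>D. (if e \<in> A then f else g) (map_prod \<phi> \<phi> e)"
  have "?h A \<le> ?h {} + real (card A) * \<delta> * real (card V) ^ card U" if "finite A" "A \<subseteq> D" for A
    using that
  proof (induction A rule: finite_induct)
    case empty
    then show ?case by simp
  next
    case (insert e A)
    obtain u w where e: "e = (u, w)" by (cases e)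
    have uw: "u \<in> U" "w \<in> U" "u \<noteq> w" using insert.prems D e by auto
    have loops: "(x, x) \<notin> D" for x using D(2)[of x x] by blast
    let ?W = "\<lambda>e. if e \<in> A then f else g"
    have pe: "(\<Prod>e'\<in>D. (if e' \<in> insert e A then f else g) (map_prod \<phi> \<phi> e')) =
      f (\<phi> u, \<phi> w) * (\<Prod>e'\<in>D - {e}. ?W e' (map_prod \<phi> \<phi> e'))" for \<phi>
      by (subst prod.remove[of D e]) (use fin insert e in \<open>auto intro!: prod.cong\<close>)
    have pe': "(\<Prod>e'\<in>D. ?W e' (map_prod \<phi> \<phi> e')) =
      g (\<phi> u, \<phi> w) * (\<Prod>e'\<in>D - {e}. ?W e' (map_prod \<phi> \<phi> e'))" for \<phi>
      by (subst prod.remove[of D e]) (use fin insert e in \<open>auto intro!: prod.cong\<close>)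
    have "?h (insert e A) - ?h A =
      (\<Sum>\<phi>\<in>U \<rightarrow>\<^sub>E V. (f (\<phi> u, \<phi> w) - g (\<phi> u, \<phi> w)) * (\<Prod>e'\<in>D - {e}. ?W e' (map_prod \<phi> \<phi> e')))"
      unfolding pe pe' sum_subtractf[symmetric] by (simp add: algebra_simps)
    also have "\<dots> \<le> \<delta> * real (card V) ^ card U"
      by (rule edge_replacement[of V U "D - {e}" "\<lambda>z. f z - g z" \<delta> ?W u w])
        (use fin cut f g uw D(2) loops insert.prems e in auto)
    finally show ?case using insert by (simp add: algebra_simps)
  qed
  from this[of D] show ?thesis using fin(3) by (simp add: hom_weight_def cong: prod.cong)
qed

section \<open>Supersaturation\<close>

text \<open>The pattern is a predicate, so that one \<open>D\<close> can be used on a vertex set, on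
  a subset of it and on an extension by a clone.\<close>

definition hom_set :: "nat set \<Rightarrow> (nat \<times> nat) set \<Rightarrow> 'a set \<Rightarrow> ('a \<Rightarrow> 'a \<Rightarrow> bool) \<Rightarrow> ('a \<Rightarrow> nat) set" where
  "hom_set V R U D = {\<phi> \<in> U \<rightarrow>\<^sub>E V. \<forall>u\<in>U. \<forall>w\<in>U. D u w \<longrightarrow> (\<phi> u, \<phi> w) \<in> R}"

lemma finite_hom_set: "finite V \<Longrightarrow> finite U \<Longrightarrow> finite (hom_set V R U D)"
  by (simp add: hom_set_def finite_PiE)

lemma hom_set_cong:
  "(\<And>u w. u \<in> U \<Longrightarrow> w \<in> U \<Longrightarrow> D u w = D' u w) \<Longrightarrow> hom_set V R U D = hom_set V R U D'"
  by (simp add: hom_set_def)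

lemma card_hom_set_le: "finite V \<Longrightarrow> finite U \<Longrightarrow> card (hom_set V R U D) \<le> card V ^ card U"
  using card_mono[of "U \<rightarrow>\<^sub>E V" "hom_set V R U D"]
  by (auto simp: hom_set_def finite_PiE card_PiE)

text \<open>Cauchy-Schwarz over the homomorphisms \<psi> of the pattern without \<open>u\<close>. If
  \<psi> has \<open>ext\<close> many extensions to \<open>u\<close>, the first power sums to the
  homomorphisms on \<open>U\<close>. As \<open>u'\<close> is a non-adjacent twin of
  \<open>u\<close>, the two images can be chosen independently, so the squares sum to at most the
  homomorphisms on \<open>insert u' U\<close>.\<close>

lemma hom_set_clone:
  assumes fin: "finite V" "finite U" and u: "u \<in> U" "u' \<notin> U"
    and D: "\<not> D u u" "\<not> D u' u'" "\<not> D u u'" "\<not> D u' u"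
      "\<And>w. w \<in> U - {u} \<Longrightarrow> D u' w = D u w" "\<And>w. w \<in> U - {u} \<Longrightarrow> D w u' = D w u"
  shows "(card (hom_set V R U D))\<^sup>2 \<le> card (hom_set V R (U - {u}) D) * card (hom_set V R (insert u' U) D)"
proof -
  let ?T = "U - {u}" and ?H = "hom_set V R U D" and ?G = "hom_set V R (U - {u}) D"
    and ?H' = "hom_set V R (insert u' U) D"
  define ext where "ext \<psi> = {x\<in>V. \<psi>(u := x) \<in> ?H}" for \<psi>
  have finext: "finite (ext \<psi>)" for \<psi> using fin by (simp add: ext_def)
  have finH0: "finite ?G" using fin by (simp add: finite_hom_set)
  have "?H \<subseteq> (\<lambda>(\<psi>, x). \<psi>(u := x)) ` Sigma ?G ext"
  proof
    fix \<phi> assume \<phi>: "\<phi> \<in> ?H"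
    let ?\<psi> = "restrict \<phi> ?T"
    have eq: "?\<psi>(u := \<phi> u) = \<phi>"
      using \<phi> u by (auto simp: hom_set_def fun_eq_iff PiE_iff extensional_def)
    moreover have "\<phi> \<in> U \<rightarrow>\<^sub>E V" using \<phi> by (simp add: hom_set_def)
    then have "\<phi> u \<in> V" using u(1) by (rule PiE_mem)
    moreover have "?\<psi> \<in> ?G" using \<phi> by (auto simp: hom_set_def)
    ultimately show "\<phi> \<in> (\<lambda>(\<psi>, x). \<psi>(u := x)) ` Sigma ?G ext"
      using \<phi> by (intro image_eqI[of _ _ "(?\<psi>, \<phi> u)"]) (auto simp: ext_def)
  qed
  then have "card ?H \<le> card (Sigma ?G ext)"
    by (intro surj_card_le) (use finH0 finext in auto)
  then have 1: "real (card ?H) \<le> (\<Sum>\<psi>\<in>?G. real (card (ext \<psi>)))"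
    using finH0 finext by (simp flip: of_nat_sum)
  have "inj_on (\<lambda>(\<psi>, x, y). \<psi>(u := x, u' := y)) (Sigma ?G (\<lambda>\<psi>. ext \<psi> \<times> ext \<psi>))"
    by (rule inj_on_inverseI[where g = "\<lambda>\<phi>. (restrict \<phi> ?T, \<phi> u, \<phi> u')"])
      (use u in \<open>auto simp: hom_set_def fun_eq_iff PiE_iff extensional_def\<close>)
  moreover have "(\<lambda>(\<psi>, x, y). \<psi>(u := x, u' := y)) ` Sigma ?G (\<lambda>\<psi>. ext \<psi> \<times> ext \<psi>) \<subseteq> ?H'"
  proof clarify
    fix \<psi> x y assume \<psi>: "\<psi> \<in> ?G" and x: "x \<in> ext \<psi>" and y: "y \<in> ext \<psi>"
    let ?\<phi> = "\<psi>(u := x, u' := y)"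
    have V: "?\<phi> \<in> insert u' U \<rightarrow>\<^sub>E V"
      using \<psi> x y u by (auto simp: hom_set_def ext_def PiE_iff extensional_def)
    have ext: "(D u w \<longrightarrow> (x, \<psi> w) \<in> R) \<and> (D w u \<longrightarrow> (\<psi> w, x) \<in> R)"
      if x: "x \<in> ext \<psi>" and w: "w \<in> ?T" for w x
    proof -
      have "\<forall>a\<in>U. \<forall>b\<in>U. D a b \<longrightarrow> ((\<psi>(u := x)) a, (\<psi>(u := x)) b) \<in> R"
        using x unfolding ext_def hom_set_def by blast
      from bspec[OF bspec[OF this u(1)], of w] bspec[OF bspec[OF this, of w] u(1)] w
      show ?thesis by simp
    qed
    have ww: "(\<psi> v, \<psi> w) \<in> R" if "v \<in> ?T" "w \<in> ?T" "D v w" for v w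
      using \<psi> that by (auto simp: hom_set_def)
    have rel: "(?\<phi> a, ?\<phi> b) \<in> R" if ab: "a \<in> insert u' U" "b \<in> insert u' U" "D a b" for a b
    proof -
      have a: "a = u' \<or> a = u \<or> a \<in> ?T" and b: "b = u' \<or> b = u \<or> b \<in> ?T" using ab by auto
      have "u \<noteq> u'" using u by auto
      have not: "w \<noteq> u \<and> w \<noteq> u'" if "w \<in> ?T" for w using that u by auto
      show ?thesis
        using a b ab(3) D ext[OF x] ext[OF y] ww not \<open>u \<noteq> u'\<close> by (elim disjE) auto
    qed
    show "?\<phi> \<in> ?H'" unfolding hom_set_def mem_Collect_eq by (intro conjI ballI impI V rel)
  qed
  ultimately have "card (Sigma ?G (\<lambda>\<psi>. ext \<psi> \<times> ext \<psi>)) \<le> card ?H'"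
    by (rule card_inj_on_le) (simp add: finite_hom_set fin)
  then have 2: "(\<Sum>\<psi>\<in>?G. (real (card (ext \<psi>)))\<^sup>2) \<le> real (card ?H')"
    using finH0 finext by (simp add: card_cartesian_product power2_eq_square flip: of_nat_sum of_nat_mult)
  have "(real (card ?H))\<^sup>2 \<le> (\<Sum>\<psi>\<in>?G. real (card (ext \<psi>)))\<^sup>2" using 1 by (intro power_mono) auto
  also have "\<dots> \<le> (\<Sum>\<psi>\<in>?G. (real (card (ext \<psi>)))\<^sup>2) * card ?G"
    by (rule sum_squared_le_sum_of_squares)
  also have "\<dots> \<le> real (card ?H') * card ?G" using 2 by (intro mult_right_mono) auto
  finally have "real ((card ?H)\<^sup>2) \<le> real (card ?G * card ?H')" by (simp add: mult.commute)
  then show ?thesis by (simp only: of_nat_le_iff)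
qed

lemma card_hom_set_reindex:
  assumes fin: "finite V" "finite I" and h: "bij_betw h I J"
    and D: "\<And>i j. i \<in> I \<Longrightarrow> j \<in> I \<Longrightarrow> D i j \<Longrightarrow> D' (h i) (h j)"
  shows "card (hom_set V R J D') \<le> card (hom_set V R I D)"
proof (rule card_inj_on_le)
  let ?F = "\<lambda>\<phi>. restrict (\<phi> \<circ> h) I"
  show "finite (hom_set V R I D)" using fin by (simp add: finite_hom_set)
  show "?F ` hom_set V R J D' \<subseteq> hom_set V R I D"
  proof clarify
    fix \<phi> assume \<phi>: "\<phi> \<in> hom_set V R J D'"
    have "h i \<in> J" if "i \<in> I" for i using h that by (auto simp: bij_betw_def)
    then show "?F \<phi> \<in> hom_set V R I D" using \<phi> D by (auto simp: hom_set_def)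
  qed
  show "inj_on ?F (hom_set V R J D')"
  proof (rule inj_onI)
    fix \<phi> \<psi> assume *: "\<phi> \<in> hom_set V R J D'" "\<psi> \<in> hom_set V R J D'" "?F \<phi> = ?F \<psi>"
    show "\<phi> = \<psi>"
    proof
      fix j show "\<phi> j = \<psi> j"
      proof (cases "j \<in> J")
        case True
        then obtain i where i: "i \<in> I" "j = h i" using h by (auto simp: bij_betw_def)
        then show ?thesis using fun_cong[OF *(3), of i] by simp
      next
        case False
        then show ?thesis using * by (auto simp: hom_set_def PiE_iff extensional_def)
      qed
    qed
  qed
qed

section \<open>Ordered cliques and the Moon-Moser inequality\<close>

lemma card_clique_homs_cong:
  assumes "finite V" "finite I" "finite J" "card I = card J"
  shows "card (hom_set V R I (\<noteq>)) = card (hom_set V R J (\<noteq>))"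
proof -
  obtain h where h: "bij_betw h I J" using assms finite_same_card_bij by blast
  have "card (hom_set V R J (\<noteq>)) \<le> card (hom_set V R I (\<noteq>))"
    by (rule card_hom_set_reindex[OF assms(1,2) h]) (use h in \<open>auto simp: bij_betw_def inj_on_def\<close>)
  moreover have "card (hom_set V R I (\<noteq>)) \<le> card (hom_set V R J (\<noteq>))"
    by (rule card_hom_set_reindex[OF assms(1,3) bij_betw_inv_into[OF h]])
      (use bij_betw_inv_into[OF h] in \<open>auto simp: bij_betw_def inj_on_def\<close>)
  ultimately show ?thesis by simp
qed

text \<open>Ordered cliques. \<open>R\<close> may have loops, as step relations do on their diagonal
  cells, and then vertices may repeat; this keeps the densities free of lower-order
  corrections.\<close>

abbreviation clique_homs :: "nat set \<Rightarrow> (nat \<times> nat) set \<Rightarrow> nat \<Rightarrow> nat" where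
  "clique_homs V R s \<equiv> card (hom_set V R {..<s} (\<noteq>))"

text \<open>Cloning the vertex \<open>i\<close> of a clique on s + 1 vertices gives the clique on s
  + 2 vertices without the edge between \<open>i\<close> and the new vertex, so
  \<open>hom_set_clone\<close> bounds \<open>card (Q i)\<close> from below. For the upper bound, all
  \<open>Q i\<close> lie in \<open>X\<close>, where the image of the new vertex is free. A map lies
  in at most one \<open>Q i\<close> unless it is a full clique, and then in s + 1 of them.\<close>

lemma Moon_Moser:
  assumes fin: "finite V"
  shows "Suc s * (clique_homs V R (Suc s))\<^sup>2 \<le>
    clique_homs V R s * (card V * clique_homs V R (Suc s) + s * clique_homs V R (Suc (Suc s)))"
proof -
  let ?I = "{..<Suc s}" and ?y = "Suc s"
  have ins: "insert ?y ?I = {..<Suc (Suc s)}" by auto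
  define D where "D i a b \<longleftrightarrow> a \<noteq> b \<and> {a, b} \<noteq> {i, ?y}" for i a b :: nat
  define Q where "Q i = hom_set V R (insert ?y ?I) (D i)" for i
  let ?K = "hom_set V R (insert ?y ?I) (\<noteq>)"
  define X where "X = {\<phi> \<in> insert ?y ?I \<rightarrow>\<^sub>E V. \<forall>a\<in>?I. \<forall>b\<in>?I. a \<noteq> b \<longrightarrow> (\<phi> a, \<phi> b) \<in> R}"
  have finX: "finite X" unfolding X_def using fin by (auto intro!: finite_PiE)
  have K: "?K \<subseteq> X" by (auto simp: X_def hom_set_def)
  have Q: "Q i \<subseteq> X" if "i \<in> ?I" for i
    by (auto simp: X_def Q_def hom_set_def D_def doubleton_eq_iff)
  have Qi: "(clique_homs V R (Suc s))\<^sup>2 \<le> clique_homs V R s * card (Q i)" if i: "i \<in> ?I" for i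
  proof -
    have "(card (hom_set V R ?I (D i)))\<^sup>2 \<le> card (hom_set V R (?I - {i}) (D i)) * card (hom_set V R (insert ?y ?I) (D i))"
      by (rule hom_set_clone) (use fin i in \<open>auto simp: D_def doubleton_eq_iff\<close>)
    moreover have "hom_set V R ?I (D i) = hom_set V R ?I (\<noteq>)"
      by (rule hom_set_cong) (auto simp: D_def doubleton_eq_iff)
    moreover have "hom_set V R (?I - {i}) (D i) = hom_set V R (?I - {i}) (\<noteq>)"
      by (rule hom_set_cong) (auto simp: D_def doubleton_eq_iff)
    moreover have "card (hom_set V R (?I - {i}) (\<noteq>)) = clique_homs V R s"
      by (rule card_clique_homs_cong) (use fin i in auto)
    ultimately show ?thesis by (simp add: Q_def)
  qed
  have point: "card {i\<in>?I. \<phi> \<in> Q i} \<le> 1 + s * of_bool (\<phi> \<in> ?K)" for \<phi>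
  proof (cases "\<phi> \<in> ?K")
    case True
    have "card {i\<in>?I. \<phi> \<in> Q i} \<le> card ?I" by (rule card_mono) auto
    then show ?thesis using True by simp
  next
    case False
    \<comment> \<open>The only pair that \<open>D i\<close> misses is the one formed by
      \<open>i\<close> and the new vertex, so for distinct \<open>i\<close> and \<open>j\<close> no
      pair is missed by both.\<close>
    have "i = j" if ij: "\<phi> \<in> Q i" "\<phi> \<in> Q j" for i j
    proof (rule ccontr)
      assume "i \<noteq> j"
      then have "D i a b \<or> D j a b" if "a \<noteq> b" for a b
        using that by (auto simp: D_def doubleton_eq_iff)
      moreover have "(\<phi> a, \<phi> b) \<in> R" if "a \<in> insert ?y ?I" "b \<in> insert ?y ?I" "D i a b \<or> D j a b" for a b
        using ij that unfolding Q_def hom_set_def by blast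
      moreover have "\<phi> \<in> insert ?y ?I \<rightarrow>\<^sub>E V" using ij by (simp add: Q_def hom_set_def)
      ultimately have "\<phi> \<in> ?K" unfolding hom_set_def by blast
      then show False using False by simp
    qed
    then have "card {i\<in>?I. \<phi> \<in> Q i} \<le> Suc 0" by (subst card_le_Suc0_iff_eq) auto
    then show ?thesis by simp
  qed
  have cardX: "card X \<le> card V * clique_homs V R (Suc s)"
  proof -
    have "inj_on (\<lambda>\<phi>. (\<phi> ?y, restrict \<phi> ?I)) X"
    proof (rule inj_onI)
      fix \<phi> \<psi> assume *: "\<phi> \<in> X" "\<psi> \<in> X" "(\<phi> ?y, restrict \<phi> ?I) = (\<psi> ?y, restrict \<psi> ?I)"
      show "\<phi> = \<psi>"
      proof
        fix i show "\<phi> i = \<psi> i"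
        proof (cases "i \<in> ?I")
          case True
          then show ?thesis using *(3) by (metis prod.inject restrict_apply')
        next
          case False
          then show ?thesis using * by (cases "i = ?y") (auto simp: X_def PiE_iff extensional_def)
        qed
      qed
    qed
    moreover have "(\<lambda>\<phi>. (\<phi> ?y, restrict \<phi> ?I)) ` X \<subseteq> V \<times> hom_set V R ?I (\<noteq>)"
      by (auto simp: X_def hom_set_def)
    ultimately have "card X \<le> card (V \<times> hom_set V R ?I (\<noteq>))"
      by (intro card_inj_on_le) (auto intro: finite_hom_set fin)
    then show ?thesis by (simp add: card_cartesian_product)
  qed
  have "Suc s * (clique_homs V R (Suc s))\<^sup>2 = (\<Sum>i\<in>?I. (clique_homs V R (Suc s))\<^sup>2)" by simp
  also have "\<dots> \<le> (\<Sum>i\<in>?I. clique_homs V R s * card (Q i))" by (rule sum_mono) (rule Qi)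
  also have "\<dots> = clique_homs V R s * (\<Sum>i\<in>?I. card (Q i))" by (simp only: sum_distrib_left)
  also have "(\<Sum>i\<in>?I. card (Q i)) = (\<Sum>i\<in>?I. card {\<phi>\<in>X. \<phi> \<in> Q i})"
    by (intro sum.cong refl arg_cong[of _ _ card]) (use Q in blast)
  also have "\<dots> = (\<Sum>\<phi>\<in>X. card {i\<in>?I. \<phi> \<in> Q i})"
    by (rule sum_multicount_gen) (use finX in auto)
  also have "\<dots> \<le> (\<Sum>\<phi>\<in>X. 1 + s * of_bool (\<phi> \<in> ?K))" by (rule sum_mono) (rule point)
  also have "\<dots> = card X + s * (\<Sum>\<phi>\<in>X. of_bool (\<phi> \<in> ?K))"
    by (simp only: sum.distrib sum_distrib_left card_eq_sum)
  also have "(\<Sum>\<phi>\<in>X. of_bool (\<phi> \<in> ?K)) = card ?K"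
    using finX K by (simp add: of_bool_def sum.If_cases Int_absorb1 cong: if_cong)
  also have "card X + s * card ?K \<le> card V * clique_homs V R (Suc s) + s * clique_homs V R (Suc (Suc s))"
    using cardX unfolding ins by simp
  finally show ?thesis by simp
qed

lemma clique_homs_1: "finite V \<Longrightarrow> clique_homs V R 1 = card V"
proof -
  assume "finite V"
  have "hom_set V R {..<1::nat} (\<noteq>) = {..<1} \<rightarrow>\<^sub>E V" by (auto simp: hom_set_def)
  then show ?thesis by (simp add: card_PiE)
qed

lemma clique_homs_2:
  assumes "finite V" "R \<subseteq> V \<times> V" "sym R"
  shows "card R \<le> clique_homs V R 2"
proof (rule card_inj_on_le)
  let ?F = "\<lambda>(x, y). (\<lambda>i\<in>{..<2::nat}. if i = 0 then x else y)"
  show "finite (hom_set V R {..<2::nat} (\<noteq>))" using assms by (simp add: finite_hom_set)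
  show "inj_on ?F R"
  proof (rule inj_onI, clarify)
    fix x y x' y' assume *: "(\<lambda>i\<in>{..<2::nat}. if i = 0 then x else y) = (\<lambda>i\<in>{..<2}. if i = 0 then x' else y')"
    show "x = x' \<and> y = y'" using fun_cong[OF *, of 0] fun_cong[OF *, of 1] by simp
  qed
  show "?F ` R \<subseteq> hom_set V R {..<2} (\<noteq>)"
    using assms by (auto simp: hom_set_def less_2_cases_iff PiE_iff dest: symD)
qed

text \<open>\<open>q\<close> is the density of non-edges. The Moon-Moser inequality turns a lower
  bound on one ratio of consecutive clique counts into a bound on the next. Positivity is carried
  along because the induction divides by clique counts; it persists as long as
  \<open>real r * q < 1\<close>.\<close>

lemma clique_homs_ratio:
  assumes fin: "finite V" and R: "sym R" "R \<subseteq> V \<times> V" and "V \<noteq> {}"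
    and q: "q = 1 - real (card R) / real (card V) ^ 2" and "real r * q < 1" and "s < r"
  shows "clique_homs V R (Suc s) > 0 \<and>
    real (clique_homs V R (Suc (Suc s))) \<ge> (1 - real (Suc s) * q) * real (card V) * real (clique_homs V R (Suc s))"
  using \<open>s < r\<close>
proof (induction s)
  case 0
  have n: "card V > 0" using fin \<open>V \<noteq> {}\<close> by auto
  have "(1 - q) * real (card V) * real (card V) = real (card R)"
    using n by (simp add: q power2_eq_square)
  also have "\<dots> \<le> real (clique_homs V R 2)" using clique_homs_2[OF fin R(2,1)] by simp
  finally show ?case using clique_homs_1[OF fin, of R] n by (simp add: numeral_2_eq_2)
next
  case (Suc s)
  let ?k = "\<lambda>s. real (clique_homs V R s)" and ?n = "real (card V)"
  have n: "card V > 0" using fin \<open>V \<noteq> {}\<close> by auto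
  have q0: "q \<ge> 0"
    using n card_mono[OF _ R(2)] fin by (simp add: q card_cartesian_product power2_eq_square flip: of_nat_mult)
  have IH: "?k (Suc s) > 0" "?k (Suc (Suc s)) \<ge> (1 - real (Suc s) * q) * ?n * ?k (Suc s)"
    using Suc by auto
  have "real (Suc s) * q \<le> real r * q" using Suc.prems q0 by (intro mult_right_mono) auto
  then have "(1 - real (Suc s) * q) > 0" using assms(6) by simp
  then have "(1 - real (Suc s) * q) * ?n * ?k (Suc s) > 0" using n IH(1) by simp
  then have pos: "?k (Suc (Suc s)) > 0" using IH(2) by linarith
  have "real (Suc (Suc s)) * (?k (Suc (Suc s)))\<^sup>2 \<le> ?k (Suc s) * (?n * ?k (Suc (Suc s)) + real (Suc s) * ?k (Suc (Suc (Suc s))))"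
    using Moon_Moser[OF fin, of "Suc s" R]
    unfolding of_nat_le_iff[where 'a = real, symmetric] of_nat_mult of_nat_add of_nat_power .
  then have upper: "real (Suc (Suc s)) * ?k (Suc (Suc s)) * ?k (Suc (Suc s)) \<le>
      ?k (Suc s) * (?n * ?k (Suc (Suc s)) + real (Suc s) * ?k (Suc (Suc (Suc s))))"
    unfolding power2_eq_square mult.assoc .
  have "real (Suc (Suc s)) * ?k (Suc (Suc s)) * ((1 - real (Suc s) * q) * ?n * ?k (Suc s))
      \<le> real (Suc (Suc s)) * ?k (Suc (Suc s)) * ?k (Suc (Suc s))"
    using IH(2) by (intro mult_left_mono) auto
  also note upper
  finally have "?k (Suc s) * (real (Suc (Suc s)) * ?k (Suc (Suc s)) * ((1 - real (Suc s) * q) * ?n))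
     \<le> ?k (Suc s) * (?n * ?k (Suc (Suc s)) + real (Suc s) * ?k (Suc (Suc (Suc s))))"
    by (simp only: mult_ac)
  then have "real (Suc (Suc s)) * ?k (Suc (Suc s)) * ((1 - real (Suc s) * q) * ?n)
     \<le> ?n * ?k (Suc (Suc s)) + real (Suc s) * ?k (Suc (Suc (Suc s)))"
    using IH(1) by (simp only: mult_le_cancel_left_pos)
  \<comment> \<open>With t = s + 1 this is the identity (t + 1)(1 - tq) - 1 = t(1 - (t +
    1)q).\<close>
  then have "real (Suc s) * ((1 - real (Suc (Suc s)) * q) * ?n * ?k (Suc (Suc s))) \<le> real (Suc s) * ?k (Suc (Suc (Suc s)))"
    by (simp add: algebra_simps)
  then have "(1 - real (Suc (Suc s)) * q) * ?n * ?k (Suc (Suc s)) \<le> ?k (Suc (Suc (Suc s)))"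
    by (subst (asm) mult_le_cancel_left_pos) auto
  then show ?case using pos by simp
qed

text \<open>At this density \<open>q\<close> is at most 1/r - \<eta>, so each of the first
  \<open>r\<close> ratios in \<open>clique_homs_ratio\<close> is at least r\<eta> \<ge> \<eta> times
  the number of vertices. Multiply them.\<close>

lemma clique_supersaturation:
  assumes fin: "finite V" and R: "sym R" "R \<subseteq> V \<times> V" and "V \<noteq> {}" and "r \<ge> 1" and "\<eta> > 0"
    and dense: "real (card R) \<ge> (1 - 1 / real r + \<eta>) * real (card V) ^ 2" and "s \<le> r"
  shows "real (clique_homs V R (Suc s)) \<ge> \<eta> ^ s * real (card V) ^ Suc s"
  using \<open>s \<le> r\<close>
proof (induction s)
  case 0
  show ?case using clique_homs_1[OF fin, of R] by simp
next
  case (Suc s)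
  define q where "q = 1 - real (card R) / real (card V) ^ 2"
  have n: "card V > 0" using fin \<open>V \<noteq> {}\<close> by auto
  have q0: "q \<ge> 0"
    using n card_mono[OF _ R(2)] fin by (simp add: q_def card_cartesian_product power2_eq_square flip: of_nat_mult)
  have "q \<le> 1 / real r - \<eta>" using dense n by (simp add: q_def field_simps)
  then have "real r * q \<le> real r * (1 / real r - \<eta>)" by (intro mult_left_mono) auto
  also have "\<dots> = 1 - real r * \<eta>" using \<open>r \<ge> 1\<close> by (simp add: field_simps)
  finally have rq: "real r * q \<le> 1 - real r * \<eta>" .
  have "real r * \<eta> \<ge> 1 * \<eta>" using \<open>r \<ge> 1\<close> \<open>\<eta> > 0\<close> by (intro mult_right_mono) auto
  then have "real r * q \<le> 1 - \<eta>" using rq by simp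
  moreover have "real (Suc s) * q \<le> real r * q" using Suc.prems q0 by (intro mult_right_mono) auto
  ultimately have \<eta>: "\<eta> \<le> 1 - real (Suc s) * q" and "real r * q < 1" using \<open>\<eta> > 0\<close> by auto
  have "\<eta> ^ Suc s * real (card V) ^ Suc (Suc s) = (\<eta> * real (card V)) * (\<eta> ^ s * real (card V) ^ Suc s)"
    by simp
  also have "\<dots> \<le> ((1 - real (Suc s) * q) * real (card V)) * real (clique_homs V R (Suc s))"
    using Suc \<eta> \<open>\<eta> > 0\<close> by (intro mult_mono) auto
  also have "\<dots> \<le> real (clique_homs V R (Suc (Suc s)))"
    using clique_homs_ratio[OF fin R \<open>V \<noteq> {}\<close> q_def \<open>real r * q < 1\<close>, of s] Suc.prems by auto
  finally show ?case .
qed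

text \<open>One representative per colour forms a clique on r + 1 vertices; every other vertex is
  added as a clone of the representative of its colour. In the clone inequality the smaller pattern
  is estimated trivially by \<open>card V ^ (card U - 1)\<close>, so each addition keeps the right
  power of \<open>card V\<close>.\<close>

lemma multipartite_supersaturation:
  fixes U :: "'a set" and col :: "'a \<Rightarrow> nat"
  assumes finU: "finite U" and col: "col ` U = {..<Suc r}" and "r \<ge> 1" and "\<eta> > 0"
  shows "\<exists>c>0. \<forall>V R. finite V \<longrightarrow> V \<noteq> {} \<longrightarrow> sym R \<longrightarrow> R \<subseteq> V \<times> V \<longrightarrow>
    real (card R) \<ge> (1 - 1 / real r + \<eta>) * real (card V) ^ 2 \<longrightarrow>
    real (card (hom_set V R U (\<lambda>u w. col u \<noteq> col w))) \<ge> c * real (card V) ^ card U"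
proof -
  let ?D = "\<lambda>u w. col u \<noteq> col w"
  have "\<exists>u\<in>U. col u = i" if "i < Suc r" for i using col that by (metis image_iff lessThan_iff)
  then obtain rep where rep: "\<And>i. i < Suc r \<Longrightarrow> rep i \<in> U \<and> col (rep i) = i" by metis
  define U0 where "U0 = rep ` {..<Suc r}"
  have U0: "U0 \<subseteq> U" "finite U0" using rep by (auto simp: U0_def)
  have bij: "bij_betw col U0 {..<Suc r}"
    using rep by (auto simp: bij_betw_def U0_def inj_on_def image_iff)
  have cU0: "card U0 = Suc r" using bij_betw_same_card[OF bij] by simp
  \<comment> \<open>Each clone squares the constant, and the clique starts with \<eta> ^ r.\<close>
  define c where "c W = (\<eta> ^ r) ^ (2 ^ card W)" for W :: "'a set"
  have "real (card (hom_set V R (U0 \<union> W) ?D)) \<ge> c W * real (card V) ^ card (U0 \<union> W)"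
    if V: "finite V" "V \<noteq> {}" "sym R" "R \<subseteq> V \<times> V"
      "real (card R) \<ge> (1 - 1 / real r + \<eta>) * real (card V) ^ 2"
      and W: "finite W" "W \<subseteq> U - U0" for V R W
    using W
  proof (induction W rule: finite_induct)
    case empty
    have "\<eta> ^ r * real (card V) ^ Suc r \<le> real (clique_homs V R (Suc r))"
      by (rule clique_supersaturation[OF V(1,3,4,2) \<open>r \<ge> 1\<close> \<open>\<eta> > 0\<close> V(5)]) simp
    also have "\<dots> \<le> real (card (hom_set V R U0 ?D))"
      by (simp, rule card_hom_set_reindex[OF V(1) U0(2) bij]) auto
    finally show ?case by (simp add: c_def cU0)
  next
    case (insert u' W)
    let ?U = "U0 \<union> W" and ?n = "real (card V)"
    have finW: "finite ?U" using insert U0 by auto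
    have u': "u' \<notin> ?U" "u' \<in> U" using insert by auto
    define u where "u = rep (col u')"
    have "col u' < Suc r" using col u'(2) by blast
    then have u: "u \<in> U0" "col u = col u'" using rep by (auto simp: u_def U0_def)
    have ins: "U0 \<union> insert u' W = insert u' ?U" by auto
    have n: "?n > 0" using V by auto
    have cU: "card (?U - {u}) + 1 = card ?U" using u finW by (metis Suc_eq_plus1 UnI1 card_Suc_Diff1)
    have "(card (hom_set V R ?U ?D))\<^sup>2 \<le> card (hom_set V R (?U - {u}) ?D) * card (hom_set V R (insert u' ?U) ?D)"
      by (rule hom_set_clone) (use V finW u u' in auto)
    also have "\<dots> \<le> card V ^ card (?U - {u}) * card (hom_set V R (insert u' ?U) ?D)"
      using finW V by (intro mult_right_mono card_hom_set_le) auto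
    finally have "real ((card (hom_set V R ?U ?D))\<^sup>2) \<le> real (card V ^ card (?U - {u}) * card (hom_set V R (insert u' ?U) ?D))"
      by (simp only: of_nat_le_iff)
    then have 1: "(real (card (hom_set V R ?U ?D)))\<^sup>2 \<le> ?n ^ card (?U - {u}) * real (card (hom_set V R (insert u' ?U) ?D))"
      by simp
    have "c W * ?n ^ card ?U \<ge> 0" using \<open>\<eta> > 0\<close> by (simp add: c_def)
    then have "(c W * ?n ^ card ?U)\<^sup>2 \<le> (real (card (hom_set V R ?U ?D)))\<^sup>2"
      using insert by (intro power_mono) auto
    also note 1
    also have "(c W * ?n ^ card ?U)\<^sup>2 = ?n ^ card (?U - {u}) * (c (insert u' W) * ?n ^ (card ?U + 1))"
      using insert.hyps unfolding cU[symmetric]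
      by (simp add: c_def power_mult_distrib power_add power2_eq_square mult_2 mult_ac)
    finally have "c (insert u' W) * ?n ^ (card ?U + 1) \<le> real (card (hom_set V R (insert u' ?U) ?D))"
      using n by (simp only: mult_le_cancel_left_pos zero_less_power)
    then show ?case unfolding ins using u'(1) finW by simp
  qed
  from this[of _ _ "U - U0"] have
    "real (card (hom_set V R U ?D)) \<ge> c (U - U0) * real (card V) ^ card U"
    if "finite V" "V \<noteq> {}" "sym R" "R \<subseteq> V \<times> V"
      "real (card R) \<ge> (1 - 1 / real r + \<eta>) * real (card V) ^ 2" for V R
    using that finU U0(1) by (simp add: Un_absorb1)
  moreover have "c (U - U0) > 0" using \<open>\<eta> > 0\<close> by (simp add: c_def)
  ultimately show ?thesis by blast
qed

section \<open>Colourings and automorphisms\<close>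

definition colouring :: "'a set \<Rightarrow> 'a set set \<Rightarrow> nat \<Rightarrow> ('a \<Rightarrow> nat) \<Rightarrow> bool" where
  "colouring V E k col \<longleftrightarrow> col ` V \<subseteq> {..<k} \<and> (\<forall>e\<in>E. \<forall>x\<in>e. \<forall>y\<in>e. x \<noteq> y \<longrightarrow> col x \<noteq> col y)"

lemma chromatic_number_altdef: "chromatic_number V E = (LEAST k. \<exists>col. colouring V E k col)"
  by (simp add: chromatic_number_def colouring_def)

lemma not_colouring: "k < chromatic_number V E \<Longrightarrow> \<not> colouring V E k col"
  unfolding chromatic_number_altdef using not_less_Least by blast

lemma graph_on_edgeE:
  assumes "graph_on V E" "e \<in> E"
  obtains x y where "e = {x, y}" "x \<noteq> y" "x \<in> V" "y \<in> V"
  using assms by (auto simp: graph_on_def card_2_iff)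

lemma colouring_chromatic_number:
  assumes "graph_on V E"
  shows "\<exists>col. colouring V E (chromatic_number V E) col"
proof -
  have fin: "finite V" using assms by (simp add: graph_on_def)
  obtain h :: "'a \<Rightarrow> nat" where h: "bij_betw h V {0..<card V}" using ex_bij_betw_finite_nat[OF fin] by blast
  have "h x \<noteq> h y" if "e \<in> E" "x \<in> e" "y \<in> e" "x \<noteq> y" for e x y
  proof -
    have "x \<in> V" "y \<in> V" using that assms by (auto simp: graph_on_def)
    then show ?thesis using h \<open>x \<noteq> y\<close> by (auto simp: bij_betw_def inj_on_def)
  qed
  then have "colouring V E (card V) h" using h by (auto simp: colouring_def bij_betw_def)
  then have "\<exists>k col. colouring V E k col" by blast
  then show ?thesis unfolding chromatic_number_altdef by (rule LeastI_ex)
qed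

lemma chromatic_number_ge_2:
  assumes "graph_on V E" "E \<noteq> {}"
  shows "chromatic_number V E \<ge> 2"
proof -
  obtain col where col: "colouring V E (chromatic_number V E) col"
    using colouring_chromatic_number[OF assms(1)] by blast
  obtain e where e: "e \<in> E" using assms by auto
  obtain x y where "e = {x, y}" "x \<noteq> y" "x \<in> V" "y \<in> V" using graph_on_edgeE[OF assms(1) e] .
  then have "col x \<noteq> col y" "col x < chromatic_number V E" "col y < chromatic_number V E"
    using col e by (auto simp: colouring_def)
  then show ?thesis by linarith
qed

text \<open>Two classes without an edge between them could be merged, giving a colouring with one
  colour fewer.\<close>

lemma colour_pair_edge:
  assumes G: "graph_on V E" and col: "colouring V E (chromatic_number V E) col"
    and ij: "i < chromatic_number V E" "j < chromatic_number V E" "i \<noteq> j"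
  shows "\<exists>e\<in>E. col ` e = {i, j}"
proof (rule ccontr)
  assume neg: "\<not> ?thesis"
  let ?\<chi> = "chromatic_number V E"
  have "card ({..<?\<chi>} - {j}) = card {..<?\<chi> - 1}" using ij by simp
  then obtain h where h: "bij_betw h ({..<?\<chi>} - {j}) {..<?\<chi> - 1}"
    using finite_same_card_bij by (metis finite_Diff finite_lessThan)
  \<comment> \<open>\<open>f\<close> merges colour \<open>j\<close> into \<open>i\<close>, and
    \<open>h\<close> renumbers the surviving colours.\<close>
  define f where "f c = (if c = j then i else c)" for c
  have f: "f (col x) \<in> {..<?\<chi>} - {j}" if "x \<in> V" for x
    using that col ij by (auto simp: f_def colouring_def)
  have "h (f (col x)) \<noteq> h (f (col y))" if e: "e \<in> E" "x \<in> e" "y \<in> e" "x \<noteq> y" for e x y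
  proof -
    have xy: "x \<in> V" "y \<in> V" using e G by (auto simp: graph_on_def)
    have "e = {x, y}" using graph_on_edgeE[OF G e(1)] e by (metis doubleton_eq_iff empty_iff insert_iff)
    then have "{col x, col y} \<noteq> {i, j}" using neg e(1) by auto
    moreover have "col x \<noteq> col y" using col e by (auto simp: colouring_def)
    ultimately have "f (col x) \<noteq> f (col y)" by (auto simp: f_def)
    then show ?thesis using h f[OF xy(1)] f[OF xy(2)] by (auto simp: bij_betw_def inj_on_def)
  qed
  moreover have "h (f (col x)) < ?\<chi> - 1" if "x \<in> V" for x
    using bij_betwE[OF h] f[OF that] by auto
  ultimately have "colouring V E (?\<chi> - 1) (h \<circ> f \<circ> col)" by (auto simp: colouring_def)
  then show False using not_colouring[of "?\<chi> - 1" V E] ij by auto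
qed

lemma colour_image_edge:
  assumes "graph_on V E" "colouring V E k col" "e \<in> E"
  shows "col ` e \<in> {A. A \<subseteq> {..<k} \<and> card A = 2}"
  by (rule graph_on_edgeE[OF assms(1,3)]) (use assms in \<open>auto simp: colouring_def\<close>)

lemma finite_edges: "graph_on V E \<Longrightarrow> finite E"
  by (rule finite_subset[of _ "Pow V"]) (auto simp: graph_on_def)

lemma colour_image_edges:
  assumes G: "graph_on V E" and col: "colouring V E (chromatic_number V E) col"
  shows "image col ` E = {A. A \<subseteq> {..<chromatic_number V E} \<and> card A = 2}"
proof
  show "image col ` E \<subseteq> {A. A \<subseteq> {..<chromatic_number V E} \<and> card A = 2}"
    using colour_image_edge[OF G col] by blast
  show "{A. A \<subseteq> {..<chromatic_number V E} \<and> card A = 2} \<subseteq> image col ` E"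
  proof
    fix A assume "A \<in> {A. A \<subseteq> {..<chromatic_number V E} \<and> card A = 2}"
    then obtain i j where A: "A = {i, j}" "i \<noteq> j" "i < chromatic_number V E" "j < chromatic_number V E"
      by (auto simp: card_2_iff)
    from colour_pair_edge[OF G col A(3,4,2)] obtain e where "e \<in> E" "col ` e = {i, j}" by blast
    then show "A \<in> image col ` E" unfolding A(1) by (metis imageI)
  qed
qed

section \<open>Graphs with the fewest edges for their chromatic number\<close>

lemma card_edges_ge:
  assumes G: "graph_on V E"
  shows "chromatic_number V E choose 2 \<le> card E"
proof -
  obtain col where col: "colouring V E (chromatic_number V E) col"
    using colouring_chromatic_number[OF G] by blast
  have "card (image col ` E) \<le> card E" by (rule card_image_le[OF finite_edges[OF G]])
  then show ?thesis unfolding colour_image_edges[OF G col] by (simp add: n_subsets)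
qed

text \<open>All colour pairs are hit, and there are as many edges as pairs: exactly one edge joins
  any two colour classes.\<close>

lemma tight_inj_on:
  assumes G: "graph_on V E" and tight: "card E = chromatic_number V E choose 2"
    and col: "colouring V E (chromatic_number V E) col"
  shows "inj_on (image col) E"
  by (rule eq_card_imp_inj_on[OF finite_edges[OF G]])
    (simp add: colour_image_edges[OF G col] n_subsets tight)

lemma tight_neighbour:
  assumes G: "graph_on V E" and tight: "card E = chromatic_number V E choose 2"
    and col: "colouring V E (chromatic_number V E) col"
    and x: "{x, z} \<in> E" and c: "c < chromatic_number V E" "c \<noteq> col x"
  shows "\<exists>y. {x, y} \<in> E \<and> col y = c"
proof (rule ccontr)
  assume neg: "\<not> ?thesis"
  \<comment> \<open>Moving \<open>x\<close> to colour class \<open>c\<close> would leave no edge between the classes of \<open>x\<close> and \<open>z\<close>.\<close>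
  let ?col = "col(x := c)" and ?\<chi> = "chromatic_number V E"
  have xz: "x \<in> V" "z \<in> V" "x \<noteq> z" using graph_on_edgeE[OF G x] by (metis doubleton_eq_iff)+
  have z: "col z \<noteq> c" "col z \<noteq> col x" "col z < ?\<chi>" "col x < ?\<chi>"
    using neg x col xz by (auto simp: colouring_def)
  have "?col v \<noteq> ?col w" if e: "e \<in> E" "v \<in> e" "w \<in> e" "v \<noteq> w" for e v w
  proof -
    have e2: "e = {v, w}" using graph_on_edgeE[OF G e(1)] e by (metis doubleton_eq_iff empty_iff insert_iff)
    have "col v \<noteq> col w" using col e by (auto simp: colouring_def)
    moreover have "col w \<noteq> c" if "v = x" using neg e(1) e2 that by auto
    moreover have "col v \<noteq> c" if "w = x" using neg e(1) e2 that by (auto simp: insert_commute)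
    ultimately show ?thesis using e(4) by auto
  qed
  then have col': "colouring V E ?\<chi> ?col" using col c by (auto simp: colouring_def)
  obtain e where e: "e \<in> E" "?col ` e = {col x, col z}"
    using colour_pair_edge[OF G col' z(4,3)] z(2) by metis
  have "x \<notin> e"
  proof
    assume "x \<in> e"
    then have "c \<in> ?col ` e" by (auto intro: image_eqI[of _ _ x])
    then show False using e(2) z c by auto
  qed
  then have "col ` e = ?col ` e" by (auto intro!: image_cong)
  then have "col ` e = col ` {x, z}" using e(2) by simp
  then have "e = {x, z}" by (rule inj_onD[OF tight_inj_on[OF G tight col] _ e(1) x])
  then show False using \<open>x \<notin> e\<close> by simp
qed

text \<open>\<open>b\<close> has a neighbour in the class of \<open>y\<close>, and \<open>y\<close>
  has one in the class of \<open>b\<close>. Only one edge joins these classes, so it is the edge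
  between \<open>b\<close> and \<open>y\<close>. Thus the two ends of an edge have the same other
  neighbours.\<close>

lemma tight_triangle:
  assumes G: "graph_on V E" and tight: "card E = chromatic_number V E choose 2"
    and ab: "{a, b} \<in> E" and ay: "{a, y} \<in> E" and "y \<noteq> b"
  shows "{b, y} \<in> E"
proof -
  let ?\<chi> = "chromatic_number V E"
  obtain col where col: "colouring V E ?\<chi> col" using colouring_chromatic_number[OF G] by blast
  note inj = inj_onD[OF tight_inj_on[OF G tight col]]
  have V: "a \<in> V" "b \<in> V" "y \<in> V" using G ab ay by (auto simp: graph_on_def)
  then have lt: "col b < ?\<chi>" "col y < ?\<chi>" using col by (auto simp: colouring_def)
  have ne: "col y \<noteq> col b"
  proof
    assume "col y = col b"
    then have "{a, b} = {a, y}" using inj[OF _ ab ay] by simp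
    then show False using \<open>y \<noteq> b\<close> by (auto simp: doubleton_eq_iff)
  qed
  obtain z where z: "{b, z} \<in> E" "col z = col y"
    using tight_neighbour[OF G tight col, of b a "col y"] ab lt ne by (auto simp: insert_commute)
  obtain w where w: "{y, w} \<in> E" "col w = col b"
    using tight_neighbour[OF G tight col, of y a "col b"] ay lt ne by (auto simp: insert_commute)
  have "{b, z} = {y, w}" using inj[OF _ z(1) w(1)] z(2) w(2) by auto
  then have "z = y" using \<open>y \<noteq> b\<close> by (auto simp: doubleton_eq_iff)
  then show ?thesis using z by simp
qed

section \<open>Copies of L and the embeddings that produce them\<close>

definition copy_of :: "'a set \<Rightarrow> 'a set set \<Rightarrow> ('a \<Rightarrow> nat) \<Rightarrow> nat set \<times> nat set set" where
  "copy_of VL EL f = (f ` VL, image f ` EL)"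

text \<open>Extensional maps make this a finite set in which maps agreeing on \<open>VL\<close> are
  not counted twice; every copy still arises from one of them.\<close>

definition embeddings :: "'a set \<Rightarrow> 'a set set \<Rightarrow> nat \<Rightarrow> nat set set \<Rightarrow> ('a \<Rightarrow> nat) set" where
  "embeddings VL EL n G = {f \<in> VL \<rightarrow>\<^sub>E {0..<n}. inj_on f VL \<and> image f ` EL \<subseteq> G}"

lemma copies_iff: "c \<in> copies VL EL n G \<longleftrightarrow>
    (\<exists>f. c = (f ` VL, image f ` EL) \<and> inj_on f VL \<and> f ` VL \<subseteq> {0..<n} \<and> image f ` EL \<subseteq> G)"
  unfolding copies_def by (rule mem_Collect_eq)

lemma copies_altdef:
  assumes "graph_on VL EL"
  shows "copies VL EL n G = copy_of VL EL ` embeddings VL EL n G"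
proof
  show "copy_of VL EL ` embeddings VL EL n G \<subseteq> copies VL EL n G"
    by (auto simp: copy_of_def embeddings_def copies_def)
  show "copies VL EL n G \<subseteq> copy_of VL EL ` embeddings VL EL n G"
  proof
    fix c assume "c \<in> copies VL EL n G"
    then obtain f where f: "c = (f ` VL, image f ` EL)" "inj_on f VL" "f ` VL \<subseteq> {0..<n}" "image f ` EL \<subseteq> G"
      by (auto simp: copies_def)
    have im: "image (restrict f VL) ` EL = image f ` EL"
      by (rule image_cong) (use assms in \<open>auto simp: graph_on_def intro!: image_cong\<close>)
    have "restrict f VL \<in> embeddings VL EL n G"
      unfolding embeddings_def using f im by (auto simp: inj_on_def)
    moreover have "c = copy_of VL EL (restrict f VL)" unfolding copy_of_def im f(1) by simp
    ultimately show "c \<in> copy_of VL EL ` embeddings VL EL n G" by blast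
  qed
qed

lemma finite_embeddings: "finite VL \<Longrightarrow> finite (embeddings VL EL n G)"
  by (rule finite_subset[of _ "VL \<rightarrow>\<^sub>E {0..<n}"]) (auto simp: embeddings_def finite_PiE)

lemma card_embeddings_le: "finite VL \<Longrightarrow> card (embeddings VL EL n G) \<le> n ^ card VL"
  using card_mono[of "VL \<rightarrow>\<^sub>E {0..<n}" "embeddings VL EL n G"]
  by (auto simp: embeddings_def finite_PiE card_PiE)

lemma finite_copies: "graph_on VL EL \<Longrightarrow> finite (copies VL EL n G)"
  by (simp add: copies_altdef finite_embeddings graph_on_def)

lemma num_copies_le:
  assumes "graph_on VL EL"
  shows "num_copies VL EL n G \<le> n ^ card VL"
proof -
  have "finite VL" using assms by (simp add: graph_on_def)
  then show ?thesis
    unfolding num_copies_def copies_altdef[OF assms]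
    using order_trans[OF card_image_le[OF finite_embeddings] card_embeddings_le] by blast
qed

lemma copies_mono: "G \<subseteq> H \<Longrightarrow> copies VL EL n G \<subseteq> copies VL EL n H"
proof
  fix c assume "G \<subseteq> H" "c \<in> copies VL EL n G"
  then obtain f where "c = (f ` VL, image f ` EL)" "inj_on f VL" "f ` VL \<subseteq> {0..<n}" "image f ` EL \<subseteq> H"
    unfolding copies_iff by (metis order_trans)
  then show "c \<in> copies VL EL n H" unfolding copies_iff by (intro exI[of _ f] conjI)
qed

lemma snd_copies: "c \<in> copies VL EL n G \<Longrightarrow> snd c \<subseteq> G"
  unfolding copies_iff by (metis snd_conv)

lemma num_copies_mono: "graph_on VL EL \<Longrightarrow> G \<subseteq> H \<Longrightarrow> num_copies VL EL n G \<le> num_copies VL EL n H"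
  unfolding num_copies_def by (rule card_mono[OF finite_copies copies_mono])

text \<open>An embedding and its composition with the automorphism are different and produce the
  same copy, so every copy uses up at least two of the at most \<open>n ^ card VL\<close>
  embeddings.\<close>

lemma num_copies_automorphism:
  assumes G: "graph_on VL EL" and ab: "a \<in> VL" "b \<in> VL" "a \<noteq> b"
    and \<sigma>: "bij_betw \<sigma> VL VL" "\<sigma> a = b" "image \<sigma> ` EL = EL"
  shows "2 * num_copies VL EL n H \<le> n ^ card VL"
proof -
  let ?E = "embeddings VL EL n H" and ?c = "copy_of VL EL"
  have fin: "finite VL" "finite ?E" using G by (auto simp: graph_on_def intro: finite_embeddings)
  have fibre: "2 \<le> card {f\<in>?E. ?c f = c}" if c: "c \<in> ?c ` ?E" for c
  proof -
    obtain f where f: "f \<in> ?E" "c = ?c f" using c by auto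
    let ?f = "restrict (f \<circ> \<sigma>) VL"
    have s: "\<sigma> x \<in> VL" if "x \<in> VL" for x using \<sigma>(1) that by (auto simp: bij_betw_def)
    have "image ?f ` EL = image (f \<circ> \<sigma>) ` EL"
      by (rule image_cong) (use G in \<open>auto simp: graph_on_def intro!: image_cong\<close>)
    also have "\<dots> = image f ` image \<sigma> ` EL" by (simp add: image_comp o_def image_image)
    finally have im: "image ?f ` EL = image f ` EL" using \<sigma>(3) by simp
    have inj: "inj_on ?f VL"
      using f(1) \<sigma>(1) s by (auto simp: embeddings_def inj_on_def bij_betw_def)
    have imV: "?f ` VL = f ` VL" 
    proof -
      have "?f ` VL = f ` \<sigma> ` VL" by (simp add: image_image)
      then show ?thesis using \<sigma>(1) by (simp only: bij_betw_def)
    qed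
    have "?f \<in> ?E" using f(1) s inj im by (auto simp: embeddings_def)
    moreover have "?c ?f = c" unfolding copy_of_def im imV f(2) by simp
    moreover have "?f \<noteq> f"
    proof
      assume "?f = f"
      then have "f b = f a" using ab(1) \<sigma>(2) by (metis comp_apply restrict_apply')
      then show False using f(1) ab by (auto simp: embeddings_def inj_on_def)
    qed
    ultimately have "{f, ?f} \<subseteq> {f\<in>?E. ?c f = c}" and "card {f, ?f} = 2" using f by auto
    then show ?thesis using card_mono[of "{f\<in>?E. ?c f = c}" "{f, ?f}"] fin(2) by simp
  qed
  have "2 * num_copies VL EL n H = (\<Sum>c\<in>?c ` ?E. 2)"
    by (simp add: num_copies_def copies_altdef[OF G])
  also have "\<dots> \<le> (\<Sum>c\<in>?c ` ?E. card {f\<in>?E. ?c f = c})" by (rule sum_mono) (rule fibre)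
  also have "\<dots> = card ?E"
    unfolding card_eq_sum by (rule sum.image_gen[OF fin(2), symmetric])
  also have "\<dots> \<le> n ^ card VL" by (rule card_embeddings_le[OF fin(1)])
  finally show ?thesis .
qed

text \<open>By \<open>tight_triangle\<close>, exchanging the ends of any edge and fixing all other
  vertices is an automorphism.\<close>

lemma tight_num_copies:
  assumes G: "graph_on VL EL" and "EL \<noteq> {}" and tight: "card EL = chromatic_number VL EL choose 2"
  shows "2 * num_copies VL EL n H \<le> n ^ card VL"
proof -
  obtain e where e: "e \<in> EL" using \<open>EL \<noteq> {}\<close> by auto
  obtain a b where ab: "e = {a, b}" "a \<noteq> b" "a \<in> VL" "b \<in> VL" using graph_on_edgeE[OF G e] .
  define \<sigma> where "\<sigma> x = (if x = a then b else if x = b then a else x)" for x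
  have inv: "\<sigma> (\<sigma> x) = x" for x by (auto simp: \<sigma>_def)
  have V: "\<sigma> x \<in> VL" if "x \<in> VL" for x using that ab by (auto simp: \<sigma>_def)
  have bij: "bij_betw \<sigma> VL VL" by (rule bij_betwI[of _ _ _ \<sigma>]) (use V inv in auto)
  have E: "\<sigma> ` e' \<in> EL" if e': "e' \<in> EL" for e'
  proof -
    obtain x y where xy: "e' = {x, y}" "x \<noteq> y" "x \<in> VL" "y \<in> VL" using graph_on_edgeE[OF G e'] .
    have ba: "{b, a} \<in> EL" "{a, b} \<in> EL" using e ab by (auto simp: insert_commute)
    have 1: "{b, z} \<in> EL" if "{a, z} \<in> EL" "z \<noteq> b" for z
      using tight_triangle[OF G tight ba(2) that] .
    have 2: "{a, z} \<in> EL" if "{b, z} \<in> EL" "z \<noteq> a" for z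
      using tight_triangle[OF G tight ba(1) that] .
    have "\<sigma> ` e' = {\<sigma> x, \<sigma> y}" using xy by simp
    then show ?thesis using e' xy 1[of x] 1[of y] 2[of x] 2[of y] ba
      by (auto simp: \<sigma>_def insert_commute split: if_splits)
  qed
  have "image \<sigma> ` EL = EL"
  proof
    show "image \<sigma> ` EL \<subseteq> EL" using E by auto
    show "EL \<subseteq> image \<sigma> ` EL"
    proof
      fix e' assume "e' \<in> EL"
      then show "e' \<in> image \<sigma> ` EL"
        using E[of e'] by (intro image_eqI[of _ _ "\<sigma> ` e'"]) (auto simp: image_image inv)
    qed
  qed
  then show ?thesis using num_copies_automorphism[OF G ab(3,4,2) bij] by (simp add: \<sigma>_def)
qed

text \<open>The number of copies in the complete graph is about \<open>n ^ v(L) / |Aut L|\<close>. When \<open>L\<close> has no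
  nontrivial automorphism, the factor \<open>2\<close> is paid for by the extra edge beyond \<open>\<chi>(L) choose 2\<close>.\<close>

lemma num_copies_chromatic:
  assumes G: "graph_on VL EL" and "EL \<noteq> {}"
  shows "2 * (chromatic_number VL EL - 1) * num_copies VL EL n H \<le> card EL * n ^ card VL"
proof -
  let ?\<chi> = "chromatic_number VL EL"
  have \<chi>: "?\<chi> \<ge> 2" by (rule chromatic_number_ge_2[OF assms])
  define s where "s = ?\<chi> - 2"
  have s: "?\<chi> = s + 2" using \<chi> by (simp add: s_def)
  have ch: "2 * (?\<chi> choose 2) = (s + 2) * (s + 1)" by (simp add: s choose_two)
  show ?thesis
  proof (cases "card EL = ?\<chi> choose 2")
    case True
    have "?\<chi> - 1 \<le> ?\<chi> choose 2"
    proof -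
      have "2 * (s + 1) \<le> (s + 2) * (s + 1)" by (rule mult_right_mono) auto
      then show ?thesis using ch s by simp
    qed
    then have "(?\<chi> - 1) * (2 * num_copies VL EL n H) \<le> card EL * n ^ card VL"
      using tight_num_copies[OF G \<open>EL \<noteq> {}\<close> True] unfolding True by (rule mult_le_mono)
    then show ?thesis by (simp add: mult_ac)
  next
    case False
    then have "card EL \<ge> (?\<chi> choose 2) + 1" using card_edges_ge[OF G] by simp
    moreover have "(?\<chi> choose 2) + 1 \<ge> 2 * (?\<chi> - 1)"
    proof -
      have "(s + 2) * (s + 1) + 2 \<ge> 4 * (s + 1)"
        by (cases s) (auto simp: algebra_simps)
      moreover have \<chi>1: "?\<chi> - 1 = s + 1" using s by simp
      ultimately show ?thesis using ch unfolding \<chi>1 by linarith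
    qed
    ultimately have "2 * (?\<chi> - 1) \<le> card EL" by simp
    then show ?thesis using num_copies_le[OF G, of n H] by (rule mult_le_mono)
  qed
qed

section \<open>Bounds on codes of graphs\<close>

lemma card_all_edges: "card (all_edges n) = n choose 2"
  using n_subsets[of "{0..<n}" 2] by (simp add: all_edges_def)

lemma finite_all_edges: "finite (all_edges n)"
  by (rule finite_subset[of _ "Pow {0..<n}"]) (auto simp: all_edges_def)

section \<open>The Turan graph on the residue classes modulo \<open>r\<close>, and edges added
  inside its parts\<close>

definition inner_edges :: "nat \<Rightarrow> nat \<Rightarrow> nat set set" where
  "inner_edges r n = {e \<in> all_edges n. \<forall>x\<in>e. \<forall>y\<in>e. x mod r = y mod r}"

text \<open>Count by the larger end \<open>y\<close>: at most \<open>y div r\<close> smaller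
  vertices are congruent to it, and r times this is at most \<open>y\<close>. Summing leaves no
  rounding error, so the upper bound will hold for each \<open>n\<close> rather than only in the
  limit.\<close>

lemma card_inner_edges: "r * card (inner_edges r n) \<le> n choose 2"
proof -
  let ?S = "SIGMA y:{..<n}. {1..y div r}"
  have "inner_edges r n \<subseteq> (\<lambda>(y, j). {y - r * j, y}) ` ?S"
  proof
    fix e assume e: "e \<in> inner_edges r n"
    then obtain a b where "e = {a, b}" "a \<noteq> b" by (auto simp: inner_edges_def all_edges_def card_2_iff)
    then obtain x y where xy: "e = {x, y}" "x < y" 
      using that[of a b] that[of b a] by (cases a b rule: linorder_cases) auto
    then have "x \<in> e" "y \<in> e" by auto
    then have "x mod r = y mod r" "e \<subseteq> {0..<n}" using e unfolding inner_edges_def all_edges_def by blast+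
    then have "y < n" using \<open>y \<in> e\<close> by auto
    have "r dvd y - x" 
      using xy(2) mod_eq_dvd_iff_nat[of x y r] \<open>x mod r = y mod r\<close> by simp
    then obtain j where j: "y - x = r * j" by (elim dvdE)
    have "r * j \<le> y" using j by linarith
    have "r > 0" "j \<ge> 1" using j xy(2) by (cases r; cases j; simp)+
    with \<open>r * j \<le> y\<close> have "j \<le> y div r" by (simp add: less_eq_div_iff_mult_less_eq mult.commute)
    moreover have "x = y - r * j" using j xy(2) by simp
    ultimately show "e \<in> (\<lambda>(y, j). {y - r * j, y}) ` ?S"
      using xy \<open>y < n\<close> \<open>j \<ge> 1\<close> by (intro image_eqI[of _ _ "(y, j)"]) auto
  qed
  then have "card (inner_edges r n) \<le> card ?S" by (intro surj_card_le) auto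
  also have "\<dots> = (\<Sum>y<n. y div r)" by simp
  finally have "r * card (inner_edges r n) \<le> (\<Sum>y<n. r * (y div r))"
    by (simp add: sum_distrib_left[symmetric])
  also have "\<dots> \<le> (\<Sum>y<n. y)" by (rule sum_mono) simp
  also have "\<dots> = n choose 2"
    by (induction n) (auto simp: numeral_2_eq_2)
  finally show ?thesis .
qed

text \<open>Otherwise reducing the embedding modulo \<open>r\<close> would colour L with fewer than
  \<chi>(L) colours.\<close>

lemma copy_inner_edge:
  assumes G: "graph_on VL EL" and r: "0 < r" "r < chromatic_number VL EL"
    and c: "c \<in> copies VL EL n (all_edges n)"
  shows "snd c \<inter> inner_edges r n \<noteq> {}"
proof
  assume empty: "snd c \<inter> inner_edges r n = {}"
  obtain f where f: "c = (f ` VL, image f ` EL)" "inj_on f VL" "image f ` EL \<subseteq> all_edges n"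
    using c by (auto simp: copies_def)
  have "f x mod r \<noteq> f y mod r" if e: "e \<in> EL" "x \<in> e" "y \<in> e" "x \<noteq> y" for e x y
  proof
    assume eq: "f x mod r = f y mod r"
    have "e = {x, y}" using graph_on_edgeE[OF G e(1)] e by (metis doubleton_eq_iff empty_iff insert_iff)
    then have "f ` e \<in> inner_edges r n" using f(3) e(1) eq by (auto simp: inner_edges_def)
    then show False using empty f(1) e(1) by auto
  qed
  then have "colouring VL EL r (\<lambda>x. f x mod r)" using r by (auto simp: colouring_def)
  then show False using not_colouring[OF r(2)] by blast
qed

lemma num_copies_Turan:
  assumes "graph_on VL EL" "0 < r" "r < chromatic_number VL EL"
  shows "num_copies VL EL n (all_edges n - inner_edges r n) = 0"
proof -
  have "copies VL EL n (all_edges n - inner_edges r n) = {}"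
  proof (rule ccontr)
    assume "\<not> ?thesis"
    then obtain c where c: "c \<in> copies VL EL n (all_edges n - inner_edges r n)" by auto
    have "c \<in> copies VL EL n (all_edges n)"
      by (rule subsetD[OF copies_mono c]) auto
    moreover have "snd c \<inter> inner_edges r n = {}" using snd_copies[OF c] by auto
    ultimately show False using copy_inner_edge[OF assms] by blast
  qed
  then show ?thesis by (simp add: num_copies_def)
qed

text \<open>Deleting a heaviest element does not raise the mean weight; repeat until
  \<open>m\<close> elements are left. The inequality between means is cross-multiplied to stay
  within the natural numbers.\<close>

lemma light_subset:
  fixes w :: "'b \<Rightarrow> nat"
  assumes "finite I" "m \<le> card I"
  shows "\<exists>S\<subseteq>I. card S = m \<and> card I * sum w S \<le> m * sum w I"
  using assms
proof (induction "card I - m" arbitrary: I)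
  case 0
  then show ?case by (intro exI[of _ I]) auto
next
  case (Suc d)
  then have ne: "I \<noteq> {}" by auto
  obtain x where x: "x \<in> I" "\<And>y. y \<in> I \<Longrightarrow> w y \<le> w x"
    using Max_in[of "w ` I"] Max_ge[of "w ` I"] ne Suc.prems(1) by (metis (no_types, lifting) finite_imageI image_iff image_is_empty)
  let ?J = "I - {x}"
  have cI: "card I = Suc (card ?J)" using x Suc.prems by (metis card.remove)
  have "d = card ?J - m" "m \<le> card ?J" using Suc.hyps(2) cI by auto
  then obtain S where S: "S \<subseteq> ?J" "card S = m" "card ?J * sum w S \<le> m * sum w ?J"
    using Suc.hyps(1)[of ?J] Suc.prems by auto
  have "sum w S \<le> m * w x" using sum_bounded_above[of S w "w x"] S x by auto
  then have "card I * sum w S \<le> m * sum w ?J + m * w x" using S(3) cI by simp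
  also have "\<dots> = m * sum w I" using x Suc.prems by (simp add: sum.remove[of I x] algebra_simps)
  finally show ?case using S by (intro exI[of _ S]) auto
qed

text \<open>The graph is the Turan graph plus \<open>m\<close> inner edges of least charge. A copy
  inside it has all its inner edges, in particular the one it is charged to, among the added ones,
  so the charges bound the number of copies.\<close>

lemma exists_graph_few_copies:
  assumes G: "graph_on VL EL" and r: "0 < r" "r < chromatic_number VL EL"
    and m: "m \<le> card (inner_edges r n)"
  shows "\<exists>H\<subseteq>all_edges n. (n choose 2) - card H = card (inner_edges r n) - m \<and>
    card (inner_edges r n) * num_copies VL EL n H \<le> m * num_copies VL EL n (all_edges n)"
proof -
  let ?I = "inner_edges r n" and ?C = "copies VL EL n (all_edges n)"
  have I: "?I \<subseteq> all_edges n" by (auto simp: inner_edges_def)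
  have finI: "finite ?I" using finite_subset[OF I finite_all_edges] .
  have finC: "finite ?C" by (rule finite_copies[OF G])
  have "\<forall>c\<in>?C. \<exists>e. e \<in> snd c \<inter> ?I" using copy_inner_edge[OF G r] by blast
  \<comment> \<open>Each copy is charged to a single inner edge, so the charges add up to the number
    of copies, however many inner edges a copy contains.\<close>
  then obtain ch where ch: "\<And>c. c \<in> ?C \<Longrightarrow> ch c \<in> snd c \<inter> ?I" by metis
  define w where "w e = card {c\<in>?C. ch c = e}" for e
  obtain S where S: "S \<subseteq> ?I" "card S = m" "card ?I * sum w S \<le> m * sum w ?I"
    using light_subset[OF finI m] by blast
  have sumw: "sum w T = card {c\<in>?C. ch c \<in> T}" if "T \<subseteq> ?I" for T
  proof -
    have "{c\<in>?C. ch c \<in> T} = (\<Union>e\<in>T. {c\<in>?C. ch c = e})" by auto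
    then show ?thesis
      unfolding w_def using finC finite_subset[OF that finI]
      by (simp add: card_UN_disjoint disjoint_iff)
  qed
  let ?H = "(all_edges n - ?I) \<union> S"
  have "copies VL EL n ?H \<subseteq> {c\<in>?C. ch c \<in> S}"
  proof
    fix c assume c: "c \<in> copies VL EL n ?H"
    have "?H \<subseteq> all_edges n" using S(1) I by auto
    then have "c \<in> ?C" by (rule subsetD[OF copies_mono c])
    moreover have "snd c \<subseteq> ?H" by (rule snd_copies[OF c])
    ultimately show "c \<in> {c\<in>?C. ch c \<in> S}" using ch[of c] by auto
  qed
  then have "num_copies VL EL n ?H \<le> sum w S"
    unfolding num_copies_def sumw[OF S(1)] by (rule card_mono[rotated]) (use finC in auto)
  moreover have "sum w ?I \<le> num_copies VL EL n (all_edges n)"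
    unfolding num_copies_def sumw[OF subset_refl] by (rule card_mono[OF finC]) auto
  ultimately have "card ?I * num_copies VL EL n ?H \<le> m * num_copies VL EL n (all_edges n)"
    using S(3) by (meson mult_le_mono2 order_trans)
  moreover have "card ?H = (n choose 2) - card ?I + m"
  proof -
    have "card ?H = card (all_edges n - ?I) + card S"
      by (rule card_Un_disjoint) (use finite_all_edges finite_subset[OF S(1) finI] S(1) in auto)
    then show ?thesis using card_Diff_subset[OF finI I] S(2) by (simp add: card_all_edges)
  qed
  moreover have "card ?I \<le> n choose 2" using card_mono[OF finite_all_edges I] by (simp add: card_all_edges)
  ultimately show ?thesis using m S(1) I by (intro exI[of _ ?H]) auto
qed

section \<open>Codes of graphs: upper bound by agreement, lower bound by covering\<close>

definition code :: "'a set \<Rightarrow> 'a set set \<Rightarrow> nat \<Rightarrow> real \<Rightarrow> nat set set set \<Rightarrow> bool" where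
  "code VL EL n k \<G> \<longleftrightarrow> \<G> \<subseteq> Pow (all_edges n) \<and>
    (\<forall>G\<in>\<G>. \<forall>G'\<in>\<G>. G \<noteq> G' \<longrightarrow> k \<le> real (num_copies VL EL n (symdiff G G')))"

lemma M_L_altdef: "M_L VL EL n k = Max {card \<G> | \<G>. code VL EL n k \<G>}"
  by (simp add: M_L_def code_def)

lemma finite_code: "code VL EL n k \<G> \<Longrightarrow> finite \<G>"
  by (rule finite_subset[of _ "Pow (all_edges n)"]) (auto simp: code_def finite_all_edges)

lemma finite_code_cards: "finite {card \<G> | \<G>. code VL EL n k \<G>}"
proof -
  have "{card \<G> | \<G>. code VL EL n k \<G>} \<subseteq> card ` Pow (Pow (all_edges n))" by (auto simp: code_def)
  then show ?thesis by (rule finite_subset) (simp add: finite_all_edges)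
qed

lemma M_L_attained: "\<exists>\<G>. code VL EL n k \<G> \<and> card \<G> = M_L VL EL n k"
proof -
  have "code VL EL n k {}" by (simp add: code_def)
  then have "M_L VL EL n k \<in> {card \<G> | \<G>. code VL EL n k \<G>}"
    unfolding M_L_altdef by (intro Max_in finite_code_cards) auto
  then show ?thesis by auto
qed

lemma card_code_le: "code VL EL n k \<G> \<Longrightarrow> card \<G> \<le> M_L VL EL n k"
  unfolding M_L_altdef by (intro Max_ge finite_code_cards) auto

lemma M_L_pos: "M_L VL EL n k \<ge> 1"
  using card_code_le[of VL EL n k "{{}}"] by (simp add: code_def)

lemma M_L_upper:
  assumes G: "graph_on VL EL" and H: "H \<subseteq> all_edges n" and k: "real (num_copies VL EL n H) < k"
  shows "M_L VL EL n k \<le> 2 ^ ((n choose 2) - card H)"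
proof -
  obtain \<G> where \<G>: "code VL EL n k \<G>" "card \<G> = M_L VL EL n k" using M_L_attained by blast
  have "inj_on (\<lambda>X. X - H) \<G>"
  proof (rule inj_onI, rule ccontr)
    fix X Y assume *: "X \<in> \<G>" "Y \<in> \<G>" "X - H = Y - H" "X \<noteq> Y"
    have "symdiff X Y \<subseteq> H" using *(3) by (auto simp: symdiff_def)
    then have "num_copies VL EL n (symdiff X Y) \<le> num_copies VL EL n H" by (rule num_copies_mono[OF G])
    moreover have "k \<le> real (num_copies VL EL n (symdiff X Y))" using \<G>(1) * by (auto simp: code_def)
    ultimately show False using k by linarith
  qed
  moreover have "(\<lambda>X. X - H) ` \<G> \<subseteq> Pow (all_edges n - H)" using \<G>(1) by (auto simp: code_def)
  ultimately have "card \<G> \<le> card (Pow (all_edges n - H))"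
    by (rule card_inj_on_le) (simp add: finite_all_edges)
  also have "\<dots> = 2 ^ ((n choose 2) - card H)"
    using H finite_subset[OF H finite_all_edges] by (simp add: card_Pow finite_all_edges card_Diff_subset card_all_edges)
  finally show ?thesis using \<G>(2) by simp
qed

lemma log_M_L_upper:
  assumes G: "graph_on VL EL" and H: "H \<subseteq> all_edges n" and k: "real (num_copies VL EL n H) < k"
  shows "log 2 (real (M_L VL EL n k)) \<le> real ((n choose 2) - card H)"
proof -
  have "real (M_L VL EL n k) \<le> 2 ^ ((n choose 2) - card H)"
    using M_L_upper[OF assms] by (metis of_nat_le_iff of_nat_numeral of_nat_power)
  then have "log 2 (real (M_L VL EL n k)) \<le> log 2 (2 ^ ((n choose 2) - card H))"
    using M_L_pos[of VL EL n k] by (subst log_le_cancel_iff) auto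
  then show ?thesis by (simp add: log_nat_power)
qed

lemma Gilbert_Varshamov:
  assumes "EL \<noteq> {}" and k: "k > 0"
  shows "2 ^ (n choose 2) \<le> M_L VL EL n k * card {X. X \<subseteq> all_edges n \<and> real (num_copies VL EL n X) < k}"
proof -
  let ?B = "{X. X \<subseteq> all_edges n \<and> real (num_copies VL EL n X) < k}"
  obtain \<G> where \<G>: "code VL EL n k \<G>" "card \<G> = M_L VL EL n k" using M_L_attained by blast
  have sym: "symdiff X Y = symdiff Y X" for X Y by (auto simp: symdiff_def)
  have finB: "finite ?B" by (rule finite_subset[of _ "Pow (all_edges n)"]) (auto simp: finite_all_edges)
  have "copies VL EL n {} = {}" using \<open>EL \<noteq> {}\<close> by (auto simp: copies_def)
  \<comment> \<open>The ball contains its centre, since L has an edge and \<open>k\<close> is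
    positive; hence an uncovered graph is new to the code and would enlarge it.\<close>
  then have empty: "{} \<in> ?B" using k by (simp add: num_copies_def)
  have "Pow (all_edges n) \<subseteq> (\<lambda>(X, Y). symdiff X Y) ` (\<G> \<times> ?B)"
  proof
    fix X assume X: "X \<in> Pow (all_edges n)"
    have "\<exists>Y\<in>\<G>. symdiff X Y \<in> ?B"
    proof (rule ccontr)
      assume neg: "\<not> ?thesis"
      have sub: "symdiff X Y \<subseteq> all_edges n" if "Y \<in> \<G>" for Y
        using that X \<G>(1) by (auto simp: symdiff_def code_def)
      have "X \<notin> \<G>" using neg empty by (auto simp: symdiff_def)
      have far: "k \<le> real (num_copies VL EL n (symdiff X Y))" if "Y \<in> \<G>" for Y
        using neg sub that by force
      then have "code VL EL n k (insert X \<G>)"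
        using \<G>(1) X sym by (auto simp: code_def)
      then have "card (insert X \<G>) \<le> card \<G>" using card_code_le \<G>(2) by metis
      then show False using \<open>X \<notin> \<G>\<close> finite_code[OF \<G>(1)] by simp
    qed
    then obtain Y where Y: "Y \<in> \<G>" "symdiff X Y \<in> ?B" by blast
    have "X = symdiff Y (symdiff X Y)" by (auto simp: symdiff_def)
    then show "X \<in> (\<lambda>(X, Y). symdiff X Y) ` (\<G> \<times> ?B)"
      using Y by (intro image_eqI[of _ _ "(Y, symdiff X Y)"]) auto
  qed
  then have "card (Pow (all_edges n)) \<le> card (\<G> \<times> ?B)"
    by (intro surj_card_le) (use finB finite_code[OF \<G>(1)] in auto)
  then show ?thesis
    using \<G>(2) by (simp add: card_Pow finite_all_edges card_all_edges card_cartesian_product)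
qed

lemma log_M_L_lower:
  assumes "EL \<noteq> {}" and k: "k > 0"
    and B: "real (card {X. X \<subseteq> all_edges n \<and> real (num_copies VL EL n X) < k}) \<le> 2 powr b"
  shows "real (n choose 2) - b \<le> log 2 (real (M_L VL EL n k))"
proof -
  let ?M = "real (M_L VL EL n k)"
  have M: "?M > 0" using M_L_pos[of VL EL n k] by simp
  have "2 powr real (n choose 2) = real (2 ^ (n choose 2))" by (simp add: powr_realpow)
  also have "\<dots> \<le> ?M * real (card {X. X \<subseteq> all_edges n \<and> real (num_copies VL EL n X) < k})"
    using Gilbert_Varshamov[OF assms(1,2), of n VL] unfolding of_nat_mult[symmetric] of_nat_le_iff .
  also have "\<dots> \<le> ?M * 2 powr b" using B by (intro mult_left_mono) auto
  finally have "2 powr (real (n choose 2) - b) \<le> ?M" by (simp add: powr_diff divide_simps)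
  then show ?thesis using M by (simp add: le_log_iff)
qed

section \<open>Graphs with few copies\<close>

lemma sum_Pow_power_card:
  fixes x :: "'b::comm_semiring_1"
  assumes "finite A"
  shows "(\<Sum>F\<in>Pow A. x ^ card F) = (1 + x) ^ card A"
  using assms
proof (induction A rule: finite_induct)
  case empty
  then show ?case by simp
next
  case (insert a A)
  have inj: "inj_on (insert a) (Pow A)" using insert.hyps(2) by (auto simp: inj_on_def)
  have "(\<Sum>F\<in>Pow (insert a A). x ^ card F) = (\<Sum>F\<in>Pow A. x ^ card F) + (\<Sum>F\<in>insert a ` Pow A. x ^ card F)"
    unfolding Pow_insert using insert.hyps by (intro sum.union_disjoint) auto
  also have "(\<Sum>F\<in>insert a ` Pow A. x ^ card F) = (\<Sum>F\<in>Pow A. x * x ^ card F)"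
    unfolding sum.reindex[OF inj] o_def
  proof (rule sum.cong[OF refl])
    fix F assume "F \<in> Pow A"
    then have "finite F" "a \<notin> F" using insert.hyps finite_subset by auto
    then show "x ^ card (insert a F) = x * x ^ card F" by simp
  qed
  also have "\<dots> = x * (\<Sum>F\<in>Pow A. x ^ card F)" by (simp only: sum_distrib_left)
  finally show ?case using insert by (simp add: algebra_simps)
qed

text \<open>A Chernoff-type estimate: give \<open>F\<close> the weight x ^ card F with x < 1. Each
  counted set weighs at least x ^ (\<epsilon>Z), while all subsets together weigh (1 + x) ^ card A
  \<le> exp (xZ).\<close>

lemma card_small_subsets:
  assumes "\<eta> > 0"
  shows "\<exists>\<epsilon>>0. \<forall>(A :: 'b set) Z. finite A \<longrightarrow> real (card A) \<le> Z \<longrightarrow>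
    real (card {F. F \<subseteq> A \<and> real (card F) \<le> \<epsilon> * Z}) \<le> 2 powr (\<eta> * Z)"
proof -
  \<comment> \<open>The exponent \<eta>Z is split in two: \<open>x\<close> makes exp (xZ) at most 2
    powr (\<eta>Z / 2), and \<epsilon> makes x powr (- \<epsilon>Z) equal to 2 powr (\<eta>Z /
    2).\<close>
  define x where "x = min (1 / 2) (\<eta> * ln 2 / 2)"
  have x: "0 < x" "x < 1" "x \<le> \<eta> * ln 2 / 2" using assms by (auto simp: x_def)
  define \<epsilon> where "\<epsilon> = \<eta> * ln 2 / (2 * - ln x)"
  have lnx: "ln x < 0" using x by simp
  have \<epsilon>: "\<epsilon> > 0" unfolding \<epsilon>_def using lnx assms by (intro divide_pos_pos) auto
  have "real (card {F. F \<subseteq> A \<and> real (card F) \<le> \<epsilon> * Z}) \<le> 2 powr (\<eta> * Z)"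
    if A: "finite A" "real (card A) \<le> Z" for A :: "'b set" and Z
  proof -
    let ?S = "{F. F \<subseteq> A \<and> real (card F) \<le> \<epsilon> * Z}"
    have Z: "Z \<ge> 0" using A(2) by (meson of_nat_0_le_iff order_trans)
    have "real (card ?S) * exp (\<epsilon> * Z * ln x) = (\<Sum>F\<in>?S. exp (\<epsilon> * Z * ln x))" by simp
    also have "\<dots> \<le> (\<Sum>F\<in>?S. x ^ card F)"
    proof (rule sum_mono)
      fix F assume F: "F \<in> ?S"
      then have "\<epsilon> * Z * ln x \<le> real (card F) * ln x" using lnx by (intro mult_right_mono_neg) auto
      then have "exp (\<epsilon> * Z * ln x) \<le> exp (real (card F) * ln x)" by simp
      also have "\<dots> = x ^ card F" using x(1) by (simp add: exp_of_nat_mult)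
      finally show "exp (\<epsilon> * Z * ln x) \<le> x ^ card F" .
    qed
    also have "\<dots> \<le> (\<Sum>F\<in>Pow A. x ^ card F)"
      using A x by (intro sum_mono2) auto
    also have "\<dots> = (1 + x) ^ card A" by (rule sum_Pow_power_card[OF A(1)])
    also have "\<dots> \<le> exp x ^ card A" using x exp_ge_add_one_self[of x] by (intro power_mono) auto
    also have "\<dots> = exp (real (card A) * x)" by (simp add: exp_of_nat_mult)
    also have "\<dots> \<le> exp (Z * (\<eta> * ln 2 / 2))"
      unfolding exp_le_cancel_iff using A(2) x(3,1) Z by (intro mult_mono) auto
    finally have "real (card ?S) \<le> exp (Z * (\<eta> * ln 2 / 2)) / exp (\<epsilon> * Z * ln x)"
      by (simp add: field_simps)
    also have "\<dots> = exp (Z * (\<eta> * ln 2 / 2) - \<epsilon> * Z * ln x)" by (simp add: exp_diff)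
    also have "Z * (\<eta> * ln 2 / 2) - \<epsilon> * Z * ln x = \<eta> * Z * ln 2"
      using lnx by (simp add: \<epsilon>_def field_simps)
    finally show ?thesis by (simp add: powr_def)
  qed
  then show ?thesis using \<epsilon> by blast
qed

section \<open>From few copies to few homomorphisms\<close>

abbreviation graph_fun :: "nat set set \<Rightarrow> nat \<times> nat \<Rightarrow> real" where
  "graph_fun G z \<equiv> of_bool ({fst z, snd z} \<in> G)"

text \<open>Chooses one direction for every edge, as the products in \<open>hom_weight\<close> and
  the hypotheses of the counting lemma require.\<close>

definition orientation :: "'a set \<Rightarrow> 'a set set \<Rightarrow> ('a \<times> 'a) set \<Rightarrow> bool" where
  "orientation V E D \<longleftrightarrow> D \<subseteq> V \<times> V \<and> (\<forall>u w. (u, w) \<in> D \<longrightarrow> {u, w} \<in> E \<and> (w, u) \<notin> D) \<and>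
    (\<forall>e\<in>E. \<exists>u w. e = {u, w} \<and> (u, w) \<in> D)"

lemma exists_orientation:
  assumes "graph_on V E"
  shows "\<exists>D. orientation V E D"
proof -
  have fin: "finite V" using assms by (simp add: graph_on_def)
  obtain h :: "'a \<Rightarrow> nat" where h: "inj_on h V"
    using ex_bij_betw_finite_nat[OF fin] by (auto simp: bij_betw_def)
  let ?D = "{(u, w). {u, w} \<in> E \<and> h u < h w}"
  have "\<exists>u w. e = {u, w} \<and> (u, w) \<in> ?D" if e: "e \<in> E" for e
  proof -
    obtain x y where xy: "e = {x, y}" "x \<noteq> y" "x \<in> V" "y \<in> V" using graph_on_edgeE[OF assms e] .
    then have "h x \<noteq> h y" using h by (auto simp: inj_on_def)
    then consider "h x < h y" | "h y < h x" by linarith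
    then show ?thesis
    proof cases
      case 1
      then show ?thesis using xy e by blast
    next
      case 2
      then show ?thesis using xy e by (intro exI[of _ y] exI[of _ x]) (simp add: insert_commute)
    qed
  qed
  then have "orientation V E ?D" using assms unfolding orientation_def graph_on_def by fastforce
  then show ?thesis by blast
qed

text \<open>An embedding maps into the vertex set of its copy, which leaves at most
  \<open>card VL ^ card VL\<close> embeddings per copy. A crude constant is harmless when copies are
  o(n ^ v(L)).\<close>

lemma card_embeddings_copies:
  assumes G: "graph_on VL EL"
  shows "card (embeddings VL EL n X) \<le> card VL ^ card VL * num_copies VL EL n X"
proof -
  have fin: "finite VL" using G by (simp add: graph_on_def)
  have "embeddings VL EL n X \<subseteq> (\<Union>c\<in>copies VL EL n X. VL \<rightarrow>\<^sub>E fst c)"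
  proof
    fix f assume f: "f \<in> embeddings VL EL n X"
    then have "copy_of VL EL f \<in> copies VL EL n X" by (simp add: copies_altdef[OF G])
    moreover have "f \<in> VL \<rightarrow>\<^sub>E fst (copy_of VL EL f)"
      using f by (auto simp: copy_of_def embeddings_def PiE_iff)
    ultimately show "f \<in> (\<Union>c\<in>copies VL EL n X. VL \<rightarrow>\<^sub>E fst c)" by blast
  qed
  moreover have c: "finite (fst c) \<and> card (fst c) = card VL" if "c \<in> copies VL EL n X" for c
    using that fin by (auto simp: copies_iff card_image)
  have "finite (\<Union>c\<in>copies VL EL n X. VL \<rightarrow>\<^sub>E fst c)"
    using finite_copies[OF G] c fin by (auto intro!: finite_PiE)
  ultimately have "card (embeddings VL EL n X) \<le> card (\<Union>c\<in>copies VL EL n X. VL \<rightarrow>\<^sub>E fst c)"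
    by (rule card_mono[rotated])
  also have "\<dots> \<le> (\<Sum>c\<in>copies VL EL n X. card (VL \<rightarrow>\<^sub>E fst c))"
    by (rule card_UN_le[OF finite_copies[OF G]])
  also have "\<dots> = (\<Sum>c\<in>copies VL EL n X. card VL ^ card VL)"
    by (rule sum.cong[OF refl]) (use c fin in \<open>simp add: card_PiE\<close>)
  finally show ?thesis by (simp add: num_copies_def mult.commute)
qed

lemma card_identified_le:
  assumes fin: "finite U" "finite V" and uw: "u \<in> U" "w \<in> U" "u \<noteq> w"
  shows "card {\<phi> \<in> U \<rightarrow>\<^sub>E V. \<phi> u = \<phi> w} \<le> card V ^ (card U - 1)"
proof -
  have "card {\<phi> \<in> U \<rightarrow>\<^sub>E V. \<phi> u = \<phi> w} \<le> card ((U - {w}) \<rightarrow>\<^sub>E V)"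
  proof (rule card_inj_on_le)
    show "inj_on (\<lambda>\<phi>. restrict \<phi> (U - {w})) {\<phi> \<in> U \<rightarrow>\<^sub>E V. \<phi> u = \<phi> w}"
    proof (rule inj_onI)
      fix \<phi> \<psi> assume *: "\<phi> \<in> {\<phi> \<in> U \<rightarrow>\<^sub>E V. \<phi> u = \<phi> w}" "\<psi> \<in> {\<phi> \<in> U \<rightarrow>\<^sub>E V. \<phi> u = \<phi> w}"
        "restrict \<phi> (U - {w}) = restrict \<psi> (U - {w})"
      have eq: "\<phi> x = \<psi> x" if "x \<in> U - {w}" for x using fun_cong[OF *(3), of x] that by simp
      have "\<phi> w = \<psi> w" using eq[of u] uw * by auto
      then show "\<phi> = \<psi>" using eq * by (intro PiE_ext[of \<phi> U "\<lambda>_. V" \<psi>]) auto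
    qed
    show "(\<lambda>\<phi>. restrict \<phi> (U - {w})) ` {\<phi> \<in> U \<rightarrow>\<^sub>E V. \<phi> u = \<phi> w} \<subseteq> (U - {w}) \<rightarrow>\<^sub>E V"
    proof clarify
      fix \<phi> assume "\<phi> \<in> U \<rightarrow>\<^sub>E V"
      then show "restrict \<phi> (U - {w}) \<in> (U - {w}) \<rightarrow>\<^sub>E V"
        unfolding restrict_PiE_iff by (auto dest: PiE_mem)
    qed
    show "finite ((U - {w}) \<rightarrow>\<^sub>E V)" using fin by (auto intro!: finite_PiE)
  qed
  also have "\<dots> = card V ^ (card U - 1)" using fin uw by (simp add: card_PiE)
  finally show ?thesis .
qed

text \<open>A homomorphism is either an embedding or identifies two vertices of L, and for each of
  the at most \<open>(card VL)\<^sup>2\<close> ordered pairs the latter leaves one free choice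
  fewer.\<close>

lemma hom_weight_graph_fun_le:
  assumes G: "graph_on VL EL" and D: "orientation VL EL D"
  shows "hom_weight {0..<n} VL D (graph_fun X) \<le>
    real (card VL ^ card VL * num_copies VL EL n X + (card VL)\<^sup>2 * n ^ (card VL - 1))"
proof -
  let ?V = "{0..<n}" and ?P = "{(u, w) \<in> VL \<times> VL. u \<noteq> w}"
  let ?N = "\<lambda>z. {\<phi> \<in> VL \<rightarrow>\<^sub>E ?V. \<phi> (fst z) = \<phi> (snd z)}"
  let ?H = "{\<phi> \<in> VL \<rightarrow>\<^sub>E ?V. \<forall>(u, w)\<in>D. {\<phi> u, \<phi> w} \<in> X}"
  have fin: "finite VL" using G by (simp add: graph_on_def)
  have finD: "finite D" by (rule finite_subset[of _ "VL \<times> VL"]) (use D fin in \<open>auto simp: orientation_def\<close>)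
  have finH: "finite (VL \<rightarrow>\<^sub>E ?V)" using fin by (auto intro!: finite_PiE)
  have "(\<Prod>e\<in>D. graph_fun X (map_prod \<phi> \<phi> e)) = of_bool (\<forall>(u, w)\<in>D. {\<phi> u, \<phi> w} \<in> X)" for \<phi>
  proof (cases "\<forall>(u, w)\<in>D. {\<phi> u, \<phi> w} \<in> X")
    case True
    then show ?thesis by (auto intro!: prod.neutral)
  next
    case False
    then obtain u w where "(u, w) \<in> D" "{\<phi> u, \<phi> w} \<notin> X" by auto
    then have "\<exists>e\<in>D. graph_fun X (map_prod \<phi> \<phi> e) = 0" by (intro bexI[of _ "(u, w)"]) auto
    then have "(\<Prod>e\<in>D. graph_fun X (map_prod \<phi> \<phi> e)) = 0" by (rule prod_zero[OF finD])
    then show ?thesis using False by (simp only: of_bool_eq)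
  qed
  then have "hom_weight ?V VL D (graph_fun X) = (\<Sum>\<phi>\<in>VL \<rightarrow>\<^sub>E ?V. of_bool (\<forall>(u, w)\<in>D. {\<phi> u, \<phi> w} \<in> X))"
    by (simp add: hom_weight_def)
  also have "\<dots> = real (card ?H)"
    using finH by (simp add: of_bool_def sum.If_cases Int_def)
  finally have eq: "hom_weight ?V VL D (graph_fun X) = real (card ?H)" .
  have "?H \<subseteq> embeddings VL EL n X \<union> (\<Union>z\<in>?P. ?N z)"
  proof
    fix \<phi> assume \<phi>: "\<phi> \<in> ?H"
    show "\<phi> \<in> embeddings VL EL n X \<union> (\<Union>z\<in>?P. ?N z)"
    proof (cases "inj_on \<phi> VL")
      case True
      have "\<phi> ` e \<in> X" if "e \<in> EL" for e
      proof -
        have "\<exists>u w. e = {u, w} \<and> (u, w) \<in> D" using D that by (simp add: orientation_def)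
        then obtain u w where "e = {u, w}" "(u, w) \<in> D" by blast
        then show ?thesis using \<phi> by auto
      qed
      then show ?thesis using \<phi> True by (auto simp: embeddings_def)
    next
      case False
      then obtain u w where uw: "u \<in> VL" "w \<in> VL" "u \<noteq> w" "\<phi> u = \<phi> w" by (auto simp: inj_on_def)
      then have "\<phi> \<in> ?N (u, w)" "(u, w) \<in> ?P" using \<phi> by auto
      then show ?thesis by blast
    qed
  qed
  moreover have finP: "finite ?P" by (rule finite_subset[of _ "VL \<times> VL"]) (use fin in auto)
  ultimately have "card ?H \<le> card (embeddings VL EL n X \<union> (\<Union>z\<in>?P. ?N z))"
    using finH by (intro card_mono) (auto intro!: finite_embeddings fin)
  also have "\<dots> \<le> card (embeddings VL EL n X) + card (\<Union>z\<in>?P. ?N z)" by (rule card_Un_le)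
  also have "\<dots> \<le> card VL ^ card VL * num_copies VL EL n X + (card VL)\<^sup>2 * n ^ (card VL - 1)"
  proof (rule add_mono[OF card_embeddings_copies[OF G]])
    have "card (\<Union>z\<in>?P. ?N z) \<le> (\<Sum>z\<in>?P. card (?N z))" by (rule card_UN_le[OF finP])
    also have "\<dots> \<le> (\<Sum>z\<in>?P. n ^ (card VL - 1))"
      by (rule sum_mono) (use card_identified_le[OF fin, of ?V] in auto)
    also have "\<dots> = card ?P * n ^ (card VL - 1)" by simp
    also have "\<dots> \<le> card (VL \<times> VL) * n ^ (card VL - 1)"
      using fin by (intro mult_right_mono card_mono) auto
    finally show "card (\<Union>z\<in>?P. ?N z) \<le> (card VL)\<^sup>2 * n ^ (card VL - 1)"
      by (simp add: card_cartesian_product power2_eq_square)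
  qed
  finally show ?thesis unfolding eq by (simp only: of_nat_le_iff)
qed

section \<open>Step graphs as containers\<close>

definition step_relation :: "nat \<Rightarrow> (nat \<Rightarrow> nat) \<Rightarrow> (nat \<times> nat) set \<Rightarrow> (nat \<times> nat) set" where
  "step_relation n p S = {z \<in> {0..<n} \<times> {0..<n}. map_prod p p z \<in> S}"

definition relation_edges :: "nat \<Rightarrow> (nat \<times> nat) set \<Rightarrow> nat set set" where
  "relation_edges n R = {e \<in> all_edges n. \<exists>(x, y)\<in>R. e = {x, y}}"

lemma card_relation_edges:
  assumes "sym R" "finite R"
  shows "2 * card (relation_edges n R) \<le> card R"
proof -
  let ?A = "{(x, y)\<in>R. x < y}"
  have finA: "finite ?A" by (rule finite_subset[OF _ assms(2)]) auto
  have "relation_edges n R \<subseteq> (\<lambda>(x, y). {x, y}) ` ?A"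
  proof
    fix e assume e: "e \<in> relation_edges n R"
    then obtain x y where xy: "(x, y) \<in> R" "e = {x, y}" "card e = 2"
      by (auto simp: relation_edges_def all_edges_def)
    then have "x \<noteq> y" by auto
    moreover have "(y, x) \<in> R" using xy assms(1) by (auto dest: symD)
    ultimately have "(x, y) \<in> ?A \<or> (y, x) \<in> ?A" using xy(1) by auto
    then show "e \<in> (\<lambda>(x, y). {x, y}) ` ?A"
      using xy(2) by (elim disjE) (force simp: insert_commute)+
  qed
  then have 1: "card (relation_edges n R) \<le> card ?A" using finA by (intro surj_card_le) auto
  have sw: "card (prod.swap ` ?A) = card ?A" by (rule card_image) (auto simp: inj_on_def)
  have "card ?A + card (prod.swap ` ?A) = card (?A \<union> prod.swap ` ?A)"
    using finA by (intro card_Un_disjoint[symmetric]) auto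
  also have "\<dots> \<le> card R" using assms by (intro card_mono) (auto dest: symD)
  finally show ?thesis using 1 sw by linarith
qed

text \<open>The container consists of the cells where the step average \<open>f\<close> of
  \<open>X\<close> is at least \<epsilon>. Each homomorphism of the multipartite pattern into it
  adds at least \<epsilon> ^ card D to the weight of \<open>f\<close>, which the counting lemma
  compares with the weight of \<open>X\<close>. So \<open>few\<close> leaves too few homomorphisms,
  and the contrapositive of \<open>sup\<close> bounds the density. What \<open>X\<close> has outside
  lies in cells of average below \<epsilon>.\<close>

lemma exists_container:
  assumes G: "graph_on VL EL" and D: "orientation VL EL D" and col: "colouring VL EL (Suc r) col"
    and sup: "\<And>R. sym R \<Longrightarrow> R \<subseteq> {0..<n} \<times> {0..<n} \<Longrightarrow> real (card R) \<ge> b * real n ^ 2 \<Longrightarrow>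
      real (card (hom_set {0..<n} R VL (\<lambda>u w. col u \<noteq> col w))) \<ge> c * real n ^ card VL"
    and "\<epsilon> > 0" "\<delta> > 0" and i: "real i * \<delta>\<^sup>2 > 1"
    and X: "X \<subseteq> all_edges n"
    and few: "hom_weight {0..<n} VL D (graph_fun X) + real (card D) * \<delta> * real n ^ card VL
      < \<epsilon> ^ card D * (c * real n ^ card VL)"
  shows "\<exists>p \<in> {0..<n} \<rightarrow>\<^sub>E {..<4 ^ i}. \<exists>S \<subseteq> {..<4 ^ i} \<times> {..<4 ^ i}.
    sym (step_relation n p S) \<and> real (card (step_relation n p S)) \<le> b * real n ^ 2 \<and>
    real (card (X - relation_edges n (step_relation n p S))) \<le> \<epsilon> * real n ^ 2"
proof -
  let ?V = "{0..<n}" and ?g = "graph_fun X"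
  have fin: "finite VL" using G by (simp add: graph_on_def)
  have finD: "finite D" by (rule finite_subset[of _ "VL \<times> VL"]) (use D fin in \<open>auto simp: orientation_def\<close>)
  obtain p where p: "p ` ?V \<subseteq> {..<4 ^ i}"
    and cut: "\<And>A B. A \<subseteq> ?V \<Longrightarrow> B \<subseteq> ?V \<Longrightarrow> (\<Sum>z\<in>A \<times> B. step_avg ?V p ?g z - ?g z) \<le> \<delta> * real (card ?V) ^ 2"
    using weak_regularity[of ?V ?g \<delta> i] \<open>\<delta> > 0\<close> i by auto
  define f where "f = step_avg ?V p ?g"
  have f01: "0 \<le> f z" "f z \<le> 1" for z
    unfolding f_def by (rule cond_avg_nonneg cond_avg_le_1, simp)+
  \<comment> \<open>Restricting the labelling places it in the finite space of extensional maps that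
    is counted in \<open>card_containers\<close>.\<close>
  define q where "q = restrict p ?V"
  define S where "S = map_prod p p ` {z \<in> ?V \<times> ?V. f z \<ge> \<epsilon>}"
  define R where "R = step_relation n q S"
  have R: "z \<in> R \<longleftrightarrow> z \<in> ?V \<times> ?V \<and> f z \<ge> \<epsilon>" for z
  proof
    assume z: "z \<in> R"
    then have zV: "z \<in> ?V \<times> ?V" by (simp add: R_def step_relation_def)
    then have "map_prod p p z \<in> S" using z by (auto simp: R_def step_relation_def q_def)
    then obtain z' where z': "map_prod p p z = map_prod p p z'" "z' \<in> {z \<in> ?V \<times> ?V. f z \<ge> \<epsilon>}"
      unfolding S_def by (rule imageE)
    have "f z = f z'" unfolding f_def by (rule cond_avg_cong) (rule z'(1))
    then have "f z \<ge> \<epsilon>" using z'(2) by simp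
    then show "z \<in> ?V \<times> ?V \<and> f z \<ge> \<epsilon>" using zV by simp
  next
    assume "z \<in> ?V \<times> ?V \<and> f z \<ge> \<epsilon>"
    then show "z \<in> R" unfolding R_def step_relation_def S_def q_def by (cases z) auto
  qed
  have Rsub: "R \<subseteq> ?V \<times> ?V" using R by blast
  have symR: "sym R"
  proof (rule symI)
    fix x y assume "(x, y) \<in> R"
    moreover have "f (x, y) = f (y, x)"
      unfolding f_def by (rule step_avg_commute) (simp add: insert_commute)
    ultimately show "(y, x) \<in> R" unfolding R by auto
  qed
  have "\<epsilon> ^ card D * real (card (hom_set ?V R VL (\<lambda>u w. col u \<noteq> col w))) \<le> hom_weight ?V VL D f"
  proof -
    let ?H = "hom_set ?V R VL (\<lambda>u w. col u \<noteq> col w)"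
    have "\<epsilon> ^ card D * real (card ?H) = (\<Sum>\<phi>\<in>?H. \<epsilon> ^ card D)" by simp
    also have "\<dots> \<le> (\<Sum>\<phi>\<in>?H. \<Prod>e\<in>D. f (map_prod \<phi> \<phi> e))"
    proof (rule sum_mono)
      fix \<phi> assume \<phi>: "\<phi> \<in> ?H"
      have "\<epsilon> \<le> f (map_prod \<phi> \<phi> e)" if e: "e \<in> D" for e
      proof -
        obtain u w where uw: "e = (u, w)" by (cases e)
        have "u \<in> VL" "w \<in> VL" "{u, w} \<in> EL" "u \<noteq> w" using D e uw unfolding orientation_def by auto
        then have "col u \<noteq> col w" using col by (auto simp: colouring_def)
        then have "(\<phi> u, \<phi> w) \<in> R" using \<phi> \<open>u \<in> VL\<close> \<open>w \<in> VL\<close> by (simp add: hom_set_def)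
        then show ?thesis using R uw by simp
      qed
      then have "(\<Prod>e\<in>D. \<epsilon>) \<le> (\<Prod>e\<in>D. f (map_prod \<phi> \<phi> e))"
        using \<open>\<epsilon> > 0\<close> by (intro prod_mono) auto
      then show "\<epsilon> ^ card D \<le> (\<Prod>e\<in>D. f (map_prod \<phi> \<phi> e))" by simp
    qed
    also have "\<dots> \<le> hom_weight ?V VL D f"
      unfolding hom_weight_def using fin f01
      by (intro sum_mono2) (auto simp: hom_set_def intro!: finite_PiE prod_nonneg)
    finally show ?thesis .
  qed
  also have "\<dots> \<le> hom_weight ?V VL D ?g + real (card D) * \<delta> * real (card ?V) ^ card VL"
    by (rule hom_weight_counting) (use fin finD cut f01 D in \<open>auto simp: f_def orientation_def\<close>)
  also have "\<dots> < \<epsilon> ^ card D * (c * real n ^ card VL)" using few by simp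
  finally have "real (card (hom_set ?V R VL (\<lambda>u w. col u \<noteq> col w))) < c * real n ^ card VL"
    using \<open>\<epsilon> > 0\<close> by (simp only: mult_less_cancel_left_pos zero_less_power)
  then have cardR: "real (card R) \<le> b * real n ^ 2"
    using sup[OF symR Rsub] by linarith
  let ?Q = "?V \<times> ?V - R"
  have "real (card (X - relation_edges n R)) \<le> \<epsilon> * real n ^ 2"
  proof -
    let ?P = "{z\<in>?Q. {fst z, snd z} \<in> X}"
    have "X - relation_edges n R \<subseteq> (\<lambda>z. {fst z, snd z}) ` ?P"
    proof
      fix e assume e: "e \<in> X - relation_edges n R"
      then have "e \<in> all_edges n" using X by auto
      then obtain x y where xy: "e = {x, y}" "x < n" "y < n" by (auto simp: all_edges_def card_2_iff)
      have "(x, y) \<notin> R" using e xy(1) \<open>e \<in> all_edges n\<close> by (auto simp: relation_edges_def)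
      then have "(x, y) \<in> ?P" using xy e by auto
      then show "e \<in> (\<lambda>z. {fst z, snd z}) ` ?P" using xy(1) by force
    qed
    then have "card (X - relation_edges n R) \<le> card ?P" by (intro surj_card_le) auto
    then have "real (card (X - relation_edges n R)) \<le> real (card ?P)" by simp
    also have "real (card ?P) = (\<Sum>z\<in>?Q. ?g z)"
      by (simp add: of_bool_def sum.If_cases Int_def)
    \<comment> \<open>\<open>f\<close> is constant on cells, so \<open>?Q\<close> is a union of
      cells and averaging preserves the sum over it.\<close>
    also have "\<dots> = (\<Sum>z\<in>?Q. f z)"
      unfolding f_def
    proof (rule sum_cond_avg_subset[symmetric])
      fix z w assume zw: "z \<in> ?V \<times> ?V" "w \<in> ?V \<times> ?V" "map_prod p p z = map_prod p p w"
      have "f z = f w" unfolding f_def by (rule cond_avg_cong) (rule zw(3))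
      then show "z \<in> ?Q \<longleftrightarrow> w \<in> ?Q" using zw(1,2) R by simp
    qed auto
    also have "\<dots> \<le> (\<Sum>z\<in>?Q. \<epsilon>)" by (rule sum_mono) (use R in force)
    also have "\<dots> = real (card ?Q) * \<epsilon>" by simp
    also have "\<dots> \<le> real (card (?V \<times> ?V)) * \<epsilon>"
      using \<open>\<epsilon> > 0\<close> card_mono[of "?V \<times> ?V" ?Q] by (intro mult_right_mono, unfold of_nat_le_iff) auto
    finally show ?thesis by (simp add: card_cartesian_product power2_eq_square mult.commute)
  qed
  moreover have "q \<in> ?V \<rightarrow>\<^sub>E {..<4 ^ i}" using p by (auto simp: q_def)
  moreover have "S \<subseteq> {..<4 ^ i} \<times> {..<4 ^ i}" using p by (auto simp: S_def)
  ultimately show ?thesis using symR cardR unfolding R_def by blast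
qed

text \<open>Each member of \<open>B\<close> is a part of its container plus a small exceptional set.
  The factors count, in order, labellings, label relations, subsets of the container (whose edges
  number at most half of its ordered pairs) and exceptional sets.\<close>

lemma card_containers:
  fixes b \<epsilon> \<eta> :: real
  assumes small: "\<And>(A :: nat set set) Z. finite A \<Longrightarrow> real (card A) \<le> Z \<Longrightarrow>
      real (card {F. F \<subseteq> A \<and> real (card F) \<le> \<epsilon> * Z}) \<le> 2 powr (\<eta> * Z)"
    and B: "\<And>X. X \<in> B \<Longrightarrow> X \<subseteq> all_edges n \<and>
      (\<exists>p \<in> {0..<n} \<rightarrow>\<^sub>E {..<T}. \<exists>S \<subseteq> {..<T} \<times> {..<T}.
      sym (step_relation n p S) \<and> real (card (step_relation n p S)) \<le> b * real n ^ 2 \<and>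
      real (card (X - relation_edges n (step_relation n p S))) \<le> \<epsilon> * real n ^ 2)"
  shows "real (card B) \<le> real T ^ n * 2 ^ (T * T) * (2 powr (b * real n ^ 2 / 2) * 2 powr (\<eta> * real n ^ 2))"
proof -
  let ?C = "({0..<n} \<rightarrow>\<^sub>E {..<T}) \<times> Pow ({..<T} \<times> {..<T})"
  define R where "R c = step_relation n (fst c) (snd c)" for c
  define C where "C = {c \<in> ?C. sym (R c) \<and> real (card (R c)) \<le> b * real n ^ 2}"
  let ?F = "{F. F \<subseteq> all_edges n \<and> real (card F) \<le> \<epsilon> * real n ^ 2}"
  let ?P = "\<lambda>c. Pow (relation_edges n (R c)) \<times> ?F"
  have finCC: "finite ?C" by (auto intro!: finite_PiE)
  have finC: "finite C" unfolding C_def using finCC by simp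
  have finF: "finite ?F" by (rule finite_subset[of _ "Pow (all_edges n)"]) (auto simp: finite_all_edges)
  have finE: "finite (relation_edges n S)" for S
    by (rule finite_subset[OF _ finite_all_edges[of n]]) (auto simp: relation_edges_def)
  have "B \<subseteq> (\<Union>c\<in>C. (\<lambda>(A, F). A \<union> F) ` ?P c)"
  proof
    fix X assume "X \<in> B"
    then obtain p S where X: "X \<subseteq> all_edges n" and c: "(p, S) \<in> ?C"
      "sym (R (p, S))" "real (card (R (p, S))) \<le> b * real n ^ 2"
      "real (card (X - relation_edges n (R (p, S)))) \<le> \<epsilon> * real n ^ 2"
      using B[of X] unfolding R_def by auto
    have "(X \<inter> relation_edges n (R (p, S)), X - relation_edges n (R (p, S))) \<in> ?P (p, S)"
      using X c(4) by auto
    moreover have "X = (X \<inter> relation_edges n (R (p, S))) \<union> (X - relation_edges n (R (p, S)))" by auto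
    ultimately have "X \<in> (\<lambda>(A, F). A \<union> F) ` ?P (p, S)" by (metis (no_types, lifting) case_prod_conv image_eqI)
    moreover have "(p, S) \<in> C" using c unfolding C_def by blast
    ultimately show "X \<in> (\<Union>c\<in>C. (\<lambda>(A, F). A \<union> F) ` ?P c)" by blast
  qed
  then have "card B \<le> card (\<Union>c\<in>C. (\<lambda>(A, F). A \<union> F) ` ?P c)"
    by (rule card_mono[rotated]) (use finC finF finE in auto)
  also have "\<dots> \<le> (\<Sum>c\<in>C. card ((\<lambda>(A, F). A \<union> F) ` ?P c))" by (rule card_UN_le[OF finC])
  also have "\<dots> \<le> (\<Sum>c\<in>C. card (?P c))"
    by (rule sum_mono, rule card_image_le) (use finF finE in auto)
  finally have "real (card B) \<le> (\<Sum>c\<in>C. real (card (?P c)))"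
    unfolding of_nat_sum[symmetric] of_nat_le_iff .
  also have "\<dots> \<le> (\<Sum>c\<in>C. 2 powr (b * real n ^ 2 / 2) * 2 powr (\<eta> * real n ^ 2))"
  proof (rule sum_mono)
    fix c assume c: "c \<in> C"
    have "finite (R c)" by (rule finite_subset[of _ "{0..<n} \<times> {0..<n}"]) (auto simp: R_def step_relation_def)
    then have "2 * card (relation_edges n (R c)) \<le> card (R c)" using c by (intro card_relation_edges) (auto simp: C_def)
    then have "2 * real (card (relation_edges n (R c))) \<le> b * real n ^ 2" using c by (simp add: C_def)
    then have "2 powr real (card (relation_edges n (R c))) \<le> 2 powr (b * real n ^ 2 / 2)" by (intro powr_mono) auto
    then have 1: "real (card (Pow (relation_edges n (R c)))) \<le> 2 powr (b * real n ^ 2 / 2)"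
      using finE by (simp add: card_Pow powr_realpow)
    have "n choose 2 \<le> n * n"
      unfolding choose_two by (rule order_trans[OF div_le_dividend]) simp
    then have "real (n choose 2) \<le> real n ^ 2"
      unfolding power2_eq_square of_nat_mult[symmetric] of_nat_le_iff .
    then have 2: "real (card ?F) \<le> 2 powr (\<eta> * real n ^ 2)"
      using small[OF finite_all_edges[of n], of "real n ^ 2"] by (simp add: card_all_edges)
    have "real (card (?P c)) = real (card (Pow (relation_edges n (R c)))) * real (card ?F)"
      by (simp only: card_cartesian_product of_nat_mult)
    also have "\<dots> \<le> 2 powr (b * real n ^ 2 / 2) * 2 powr (\<eta> * real n ^ 2)" by (rule mult_mono[OF 1 2]) auto
    finally show "real (card (?P c)) \<le> 2 powr (b * real n ^ 2 / 2) * 2 powr (\<eta> * real n ^ 2)" .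
  qed
  also have "\<dots> = real (card C) * (2 powr (b * real n ^ 2 / 2) * 2 powr (\<eta> * real n ^ 2))" by simp
  also have "\<dots> \<le> real (card ?C) * (2 powr (b * real n ^ 2 / 2) * 2 powr (\<eta> * real n ^ 2))"
    by (rule mult_right_mono) (use finCC in \<open>auto simp: C_def intro!: card_mono\<close>)
  also have "real (card ?C) = real T ^ n * 2 ^ (T * T)"
    by (simp add: card_cartesian_product card_PiE card_Pow)
  finally show ?thesis .
qed

lemma colouring_image:
  assumes "graph_on V E" "E \<noteq> {}" and col: "colouring V E (chromatic_number V E) col"
  shows "col ` V = {..<chromatic_number V E}"
proof
  let ?\<chi> = "chromatic_number V E"
  show "col ` V \<subseteq> {..<?\<chi>}" using col by (simp add: colouring_def)
  show "{..<?\<chi>} \<subseteq> col ` V"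
  proof
    fix i assume i: "i \<in> {..<?\<chi>}"
    obtain j where j: "j < ?\<chi>" "i \<noteq> j"
      using chromatic_number_ge_2[OF assms(1,2)] that[of 0] that[of 1] by (cases "i = 0") auto
    obtain e where "e \<in> E" "col ` e = {i, j}" using colour_pair_edge[OF assms(1) col _ j] i by auto
    moreover have "e \<subseteq> V" using assms(1) \<open>e \<in> E\<close> by (simp add: graph_on_def)
    ultimately show "i \<in> col ` V" by blast
  qed
qed

text \<open>The constants are fixed in the order \<eta>, then \<open>c\<close> and \<epsilon>, then
  \<delta>, then \<open>i\<close>. All are independent of \<open>n\<close>, so the number of
  containers is only 2 ^ O(n).\<close>

lemma card_few_copies:
  fixes k :: "nat \<Rightarrow> real"
  assumes G: "graph_on VL EL" and ne: "EL \<noteq> {}" and r: "chromatic_number VL EL = Suc r"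
    and k: "k \<in> o(\<lambda>n. real n ^ card VL)" and "\<theta> > 0"
  shows "\<forall>\<^sub>F n in sequentially. real (card {X. X \<subseteq> all_edges n \<and> real (num_copies VL EL n X) < k n})
    \<le> 2 powr ((1 - 1 / real r + \<theta>) * real n ^ 2 / 2)"
proof -
  let ?v = "card VL"
  have finV: "finite VL" using G by (simp add: graph_on_def)
  have r1: "r \<ge> 1" using chromatic_number_ge_2[OF G ne] r by simp
  obtain col where col: "colouring VL EL (Suc r) col" using colouring_chromatic_number[OF G] r by auto
  have colim: "col ` VL = {..<Suc r}" using colouring_image[OF G ne] col r by simp
  then have "VL \<noteq> {}" by auto
  then have v: "?v \<ge> 1" using finV by (simp add: Suc_le_eq card_gt_0_iff)
  define \<eta> where "\<eta> = \<theta> / 5"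
  have \<eta>: "\<eta> > 0" using \<open>\<theta> > 0\<close> by (simp add: \<eta>_def)
  obtain c where c: "c > 0" and sup: "\<And>V R. finite V \<Longrightarrow> V \<noteq> {} \<Longrightarrow> sym R \<Longrightarrow> R \<subseteq> V \<times> V \<Longrightarrow>
    real (card R) \<ge> (1 - 1 / real r + \<eta>) * real (card V) ^ 2 \<Longrightarrow>
    real (card (hom_set V R VL (\<lambda>u w. col u \<noteq> col w))) \<ge> c * real (card V) ^ card VL"
    using multipartite_supersaturation[OF finV colim r1 \<eta>] by blast
  obtain \<epsilon> where \<epsilon>: "\<epsilon> > 0" and small: "\<And>(A :: nat set set) Z. finite A \<Longrightarrow> real (card A) \<le> Z \<Longrightarrow>
    real (card {F. F \<subseteq> A \<and> real (card F) \<le> \<epsilon> * Z}) \<le> 2 powr (\<eta> * Z)"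
    using card_small_subsets[OF \<eta>, where 'b = "nat set"] by blast
  obtain D where D: "orientation VL EL D" using exists_orientation[OF G] by blast
  define \<kappa> where "\<kappa> = \<epsilon> ^ card D * c"
  have \<kappa>: "\<kappa> > 0" using \<epsilon> c by (simp add: \<kappa>_def)
  \<comment> \<open>Copies, non-injective maps and the counting error may each take a quarter of
    \<kappa>, so that their sum stays strictly below \<kappa>.\<close>
  define \<delta> where "\<delta> = \<kappa> / (4 * (real (card D) + 1))"
  have \<delta>: "\<delta> > 0" using \<kappa> by (simp add: \<delta>_def)
  have D\<delta>: "real (card D) * \<delta> \<le> \<kappa> / 4" using \<kappa> by (simp add: \<delta>_def field_simps)
  obtain i where i: "real i * \<delta>\<^sup>2 > 1" using reals_Archimedean3[of "\<delta>\<^sup>2"] \<delta> by auto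
  let ?T = "4 ^ i :: nat"
  have ev1: "\<forall>\<^sub>F n in sequentially. real (?v ^ ?v) * k n \<le> \<kappa> / 4 * real n ^ ?v"
  proof -
    have "\<kappa> / (4 * (real (?v ^ ?v) + 1)) > 0" using \<kappa> by (simp add: add_nonneg_pos)
    from landau_o.smallD[OF k this]
    have "\<forall>\<^sub>F n in sequentially. norm (k n) \<le> \<kappa> / (4 * (real (?v ^ ?v) + 1)) * norm (real n ^ ?v)" .
    then show ?thesis
    proof eventually_elim
      case (elim n)
      have "real (?v ^ ?v) * k n \<le> real (?v ^ ?v) * (\<kappa> / (4 * (real (?v ^ ?v) + 1)) * real n ^ ?v)"
        using elim by (intro mult_left_mono) auto
      also have "\<dots> = (real (?v ^ ?v) * (\<kappa> / (4 * (real (?v ^ ?v) + 1)))) * real n ^ ?v" by simp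
      also have "\<dots> \<le> \<kappa> / 4 * real n ^ ?v"
        using \<kappa> by (intro mult_right_mono) (auto simp: divide_simps add_nonneg_pos)
      finally show ?case .
    qed
  qed
  have ev2: "\<forall>\<^sub>F n in sequentially. real (?v\<^sup>2) * 4 / \<kappa> \<le> real n"
    by (rule eventually_compose_filterlim[OF eventually_ge_at_top filterlim_real_sequentially])
  have ev3: "\<forall>\<^sub>F n in sequentially. (2 * real i + real (?T * ?T)) / \<eta> \<le> real n"
    by (rule eventually_compose_filterlim[OF eventually_ge_at_top filterlim_real_sequentially])
  show ?thesis using ev1 ev2 ev3 eventually_gt_at_top[of 0]
  proof eventually_elim
    case (elim n)
    let ?n = "real n" and ?b = "1 - 1 / real r + \<eta>"
    let ?B = "{X. X \<subseteq> all_edges n \<and> real (num_copies VL EL n X) < k n}"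
    have nv: "?n ^ ?v > 0" using elim(4) by simp
    have "real (?v\<^sup>2) * ?n ^ (?v - 1) \<le> \<kappa> / 4 * ?n ^ ?v"
    proof -
      have "?n ^ ?v = ?n * ?n ^ (?v - 1)" using v by (simp add: power_eq_if)
      moreover have "real (?v\<^sup>2) * ?n ^ (?v - 1) \<le> (\<kappa> / 4 * ?n) * ?n ^ (?v - 1)"
        using elim(2) \<kappa> by (intro mult_right_mono) (auto simp: field_simps)
      ultimately show ?thesis by simp
    qed
    note ev2' = this
    have "real (card ?B) \<le> real ?T ^ n * 2 ^ (?T * ?T) * (2 powr (?b * ?n ^ 2 / 2) * 2 powr (\<eta> * ?n ^ 2))"
    proof (rule card_containers[OF small], assumption, assumption)
      fix X assume X: "X \<in> ?B"
      have "hom_weight {0..<n} VL D (graph_fun X) \<le> real (?v ^ ?v) * real (num_copies VL EL n X) + real (?v\<^sup>2) * ?n ^ (?v - 1)"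
        using hom_weight_graph_fun_le[OF G D, of n X] by simp
      also have "\<dots> \<le> real (?v ^ ?v) * k n + real (?v\<^sup>2) * ?n ^ (?v - 1)"
        using X by (intro add_right_mono mult_left_mono) auto
      also have "\<dots> \<le> \<kappa> / 4 * ?n ^ ?v + \<kappa> / 4 * ?n ^ ?v"
        by (rule add_mono[OF elim(1) ev2'])
      finally have 1: "hom_weight {0..<n} VL D (graph_fun X) \<le> \<kappa> / 2 * ?n ^ ?v" by simp
      have 2: "real (card D) * \<delta> * ?n ^ ?v \<le> \<kappa> / 4 * ?n ^ ?v" using D\<delta> by (intro mult_right_mono) auto
      have "\<kappa> / 2 * ?n ^ ?v + \<kappa> / 4 * ?n ^ ?v < \<kappa> * ?n ^ ?v" using mult_pos_pos[OF \<kappa> nv] by simp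
      moreover have "\<epsilon> ^ card D * (c * ?n ^ ?v) = \<kappa> * ?n ^ ?v" by (simp add: \<kappa>_def)
      ultimately have few: "hom_weight {0..<n} VL D (graph_fun X) + real (card D) * \<delta> * ?n ^ ?v < \<epsilon> ^ card D * (c * ?n ^ ?v)"
        using 1 2 by linarith
      have "{0..<n} \<noteq> {}" using elim(4) by auto
      then have sup': "real (card (hom_set {0..<n} R VL (\<lambda>u w. col u \<noteq> col w))) \<ge> c * ?n ^ ?v"
        if "sym R" "R \<subseteq> {0..<n} \<times> {0..<n}" "real (card R) \<ge> ?b * ?n ^ 2" for R
        using sup[of "{0..<n}" R] that by simp
      show "X \<subseteq> all_edges n \<and> (\<exists>p \<in> {0..<n} \<rightarrow>\<^sub>E {..<?T}. \<exists>S \<subseteq> {..<?T} \<times> {..<?T}.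
          sym (step_relation n p S) \<and> real (card (step_relation n p S)) \<le> ?b * ?n ^ 2 \<and>
          real (card (X - relation_edges n (step_relation n p S))) \<le> \<epsilon> * ?n ^ 2)"
        using exists_container[OF G D col sup' \<epsilon> \<delta> i _ few] X by blast
    qed
    also have "real ?T ^ n * 2 ^ (?T * ?T) = 2 powr (2 * real i * ?n + real (?T * ?T))"
    proof -
      have "real ?T ^ n = 2 ^ (2 * i * n)" by (simp add: power_mult)
      then have "real ?T ^ n * 2 ^ (?T * ?T) = 2 ^ (2 * i * n + ?T * ?T)" by (simp only: power_add)
      also have "\<dots> = 2 powr real (2 * i * n + ?T * ?T)" by (simp only: powr_realpow zero_less_numeral)
      finally show ?thesis by simp
    qed
    also have "2 powr (2 * real i * ?n + real (?T * ?T)) * (2 powr (?b * ?n ^ 2 / 2) * 2 powr (\<eta> * ?n ^ 2))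
      = 2 powr (2 * real i * ?n + real (?T * ?T) + (?b * ?n ^ 2 / 2 + \<eta> * ?n ^ 2))"
      by (simp only: powr_add)
    also have "\<dots> \<le> 2 powr ((1 - 1 / real r + \<theta>) * ?n ^ 2 / 2)"
    proof (rule powr_mono)
      have n1: "?n \<ge> 1" using elim(4) by simp
      have "2 * real i * ?n + real (?T * ?T) \<le> 2 * real i * ?n + real (?T * ?T) * ?n"
        using mult_left_mono[OF n1, of "real (?T * ?T)"] by simp
      also have "\<dots> = (2 * real i + real (?T * ?T)) * ?n" by (rule distrib_right[symmetric])
      also have "\<dots> \<le> (\<eta> * ?n) * ?n"
        using elim(3) \<eta> n1 unfolding pos_divide_le_eq[OF \<eta>] by (intro mult_right_mono) (auto simp: mult.commute)
      finally have "2 * real i * ?n + real (?T * ?T) \<le> \<eta> * ?n ^ 2" by (simp add: power2_eq_square)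
      moreover have "(1 - 1 / real r + \<theta>) * ?n ^ 2 / 2 = \<eta> * ?n ^ 2 + (?b * ?n ^ 2 / 2 + \<eta> * ?n ^ 2)"
      proof -
        have "(a + 5 * \<eta>) * N / 2 = \<eta> * N + ((a + \<eta>) * N / 2 + \<eta> * N)" for a N by (simp add: field_simps)
        then show ?thesis by (simp add: \<eta>_def)
      qed
      ultimately show "2 * real i * ?n + real (?T * ?T) + (?b * ?n ^ 2 / 2 + \<eta> * ?n ^ 2) \<le> (1 - 1 / real r + \<theta>) * ?n ^ 2 / 2"
        by linarith
    qed simp
    finally show ?case .
  qed
qed

lemma log_M_L_le_linear:
  assumes G: "graph_on VL EL" and ne: "EL \<noteq> {}" and r: "chromatic_number VL EL = Suc r"
    and c: "c > 0" "2 * c / real (card EL) \<le> 1 / real r" and n: "n \<ge> 1"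
  shows "log 2 (real (M_L VL EL n (c * real n ^ card VL)))
    \<le> (1 / real r - 2 * c / real (card EL)) * real (n choose 2) + 1"
proof -
  let ?k = "c * real n ^ card VL" and ?I = "inner_edges r n" and ?e = "real (card EL)"
  have r1: "r \<ge> 1" using chromatic_number_ge_2[OF G ne] r by simp
  then have rr: "0 < r" "r < chromatic_number VL EL" using r by auto
  have e: "?e > 0" using finite_edges[OF G] ne by (simp add: card_gt_0_iff)
  have kpos: "?k > 0" using c(1) n by simp
  \<comment> \<open>The share of inner edges to be added. As the complete graph has at most e(L) n ^
    v(L) / (2r) copies by \<open>num_copies_chromatic\<close>, a share below \<gamma> gives fewer
    than c n ^ v(L) copies.\<close>
  define \<gamma> where "\<gamma> = 2 * real r * c / ?e"
  have \<gamma>: "\<gamma> > 0" "\<gamma> \<le> 1" using c e r1 by (auto simp: \<gamma>_def field_simps)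
  have rI: "real r * real (card ?I) \<le> real (n choose 2)"
    using card_inner_edges[of r n] unfolding of_nat_mult[symmetric] of_nat_le_iff .
  have "log 2 (real (M_L VL EL n ?k)) \<le> (1 - \<gamma>) * real (card ?I) + 1"
  proof (cases "card ?I = 0")
    \<comment> \<open>Without inner edges the complete graph is its own Turan graph and has no copy
      of L.\<close>
    case True
    have "finite ?I" by (rule finite_subset[OF _ finite_all_edges[of n]]) (auto simp: inner_edges_def)
    then have "?I = {}" using True by simp
    then have "num_copies VL EL n (all_edges n) = 0" using num_copies_Turan[OF G rr, of n] by simp
    then show ?thesis using log_M_L_upper[OF G subset_refl, of n ?k] kpos True by (simp add: card_all_edges)
  next
    case False
    \<comment> \<open>The largest integer strictly below \<gamma> \<open>card ?I\<close>: strictness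
      is needed to get fewer than \<open>?k\<close> copies, and the rounding causes the final +
      1.\<close>
    define m where "m = nat (\<lceil>\<gamma> * real (card ?I)\<rceil> - 1)"
    have pos: "\<gamma> * real (card ?I) > 0" using \<gamma> False by simp
    then have m: "real m = of_int \<lceil>\<gamma> * real (card ?I)\<rceil> - 1" by (simp add: m_def)
    have m1: "real m < \<gamma> * real (card ?I)" and m2: "real m \<ge> \<gamma> * real (card ?I) - 1" using m by linarith+
    have "\<gamma> * real (card ?I) \<le> 1 * real (card ?I)" using \<gamma> by (intro mult_right_mono) auto
    then have mI: "m \<le> card ?I" using m1 by simp
    obtain H where H: "H \<subseteq> all_edges n" "(n choose 2) - card H = card ?I - m"
      "card ?I * num_copies VL EL n H \<le> m * num_copies VL EL n (all_edges n)"
      using exists_graph_few_copies[OF G rr mI] by blast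
    let ?N = "real (num_copies VL EL n (all_edges n))"
    have "real (2 * (Suc r - 1) * num_copies VL EL n (all_edges n)) \<le> real (card EL * n ^ card VL)"
      using num_copies_chromatic[OF G ne, of n "all_edges n"] unfolding r of_nat_le_iff .
    then have N: "2 * real r * ?N \<le> ?e * real n ^ card VL" by simp
    have "2 * real r * (real (card ?I) * real (num_copies VL EL n H)) \<le> 2 * real r * (real m * ?N)"
      using H(3) by (intro mult_left_mono) (simp_all flip: of_nat_mult)
    also have "\<dots> = real m * (2 * real r * ?N)" by simp
    also have "\<dots> \<le> real m * (?e * real n ^ card VL)" using N by (intro mult_left_mono) auto
    also have "\<dots> < (\<gamma> * real (card ?I)) * (?e * real n ^ card VL)"
      using m1 e n by (intro mult_strict_right_mono) auto
    also have "\<dots> = 2 * real r * (real (card ?I) * ?k)" using e by (simp add: \<gamma>_def)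
    finally have "real (num_copies VL EL n H) < ?k" using False r1 by simp
    then have "log 2 (real (M_L VL EL n ?k)) \<le> real (card ?I - m)"
      using log_M_L_upper[OF G H(1)] H(2) by metis
    also have "\<dots> = real (card ?I) - real m" using mI by (simp add: of_nat_diff)
    also have "\<dots> \<le> (1 - \<gamma>) * real (card ?I) + 1" using m2 by (simp add: algebra_simps)
    finally show ?thesis .
  qed
  also have "(1 - \<gamma>) * real (card ?I) \<le> (1 - \<gamma>) * (real (n choose 2) / real r)"
    using \<gamma> rI r1 by (intro mult_left_mono) (auto simp: field_simps)
  also have "\<dots> = (1 / real r - 2 * c / ?e) * real (n choose 2)"
    using r1 by (simp add: \<gamma>_def field_simps)
  finally show ?thesis by simp
qed

section \<open>From estimates in \<open>n ^ 2 / 2\<close> to limits relative to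
  \<open>n choose 2\<close>\<close>

lemma choose_two_ratio: "(\<lambda>n. real n ^ 2 / 2 / real (n choose 2)) \<longlonglongrightarrow> 1"
proof -
  have "\<forall>\<^sub>F n in sequentially. 1 + 1 / (real n - 1) = real n ^ 2 / 2 / real (n choose 2)"
    using eventually_gt_at_top[of 1]
  proof eventually_elim
    case (elim n)
    have "real (n choose 2) = real n * (real n - 1) / 2"
      using elim by (simp add: choose_two real_of_nat_div of_nat_diff)
    moreover have "real n - 1 > 0" using elim by simp
    ultimately show ?case using elim by (simp add: divide_simps power2_eq_square)
  qed
  moreover have "(\<lambda>n. 1 + 1 / (real n - 1)) \<longlonglongrightarrow> 1"
  proof -
    have "filterlim (\<lambda>n. real n - 1) at_top sequentially"
      using filterlim_tendsto_add_at_top[OF tendsto_const[of "-1"] filterlim_real_sequentially] by simp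
    then have "(\<lambda>n. inverse (real n - 1)) \<longlonglongrightarrow> 0" by (rule tendsto_inverse_0_at_top)
    from tendsto_add[OF tendsto_const[of 1] this] show ?thesis by (simp add: inverse_eq_divide)
  qed
  ultimately show ?thesis by (rule Lim_transform_eventually[rotated])
qed

lemma inverse_choose_two: "(\<lambda>n. 1 / real (n choose 2)) \<longlonglongrightarrow> 0"
proof -
  have "(\<lambda>n. (real n ^ 2 / 2 / real (n choose 2)) * (2 * (inverse (real n)) ^ 2)) \<longlonglongrightarrow> 1 * (2 * 0 ^ 2)"
    by (intro tendsto_intros choose_two_ratio tendsto_inverse_0_at_top filterlim_real_sequentially)
  moreover have "\<forall>\<^sub>F n in sequentially.
      (real n ^ 2 / 2 / real (n choose 2)) * (2 * (inverse (real n)) ^ 2) = 1 / real (n choose 2)"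
    using eventually_gt_at_top[of 0] by eventually_elim (simp add: field_simps)
  ultimately show ?thesis by (simp add: Lim_transform_eventually)
qed

theorem theorem1p3:
  fixes VL :: "'a set" and EL :: "'a set set"
  assumes L: "graph_on VL EL" and nonempty: "EL \<noteq> {}"
  shows "(\<forall>k :: nat \<Rightarrow> nat. (\<forall>n. k n \<ge> 1) \<and> (\<lambda>n. real (k n)) \<in> o(\<lambda>n. real n ^ card VL) \<longrightarrow>
           ((\<lambda>n. log 2 (real (M_L VL EL n (real (k n)))) / real (n choose 2))
              \<longlongrightarrow> 1 / (real (chromatic_number VL EL) - 1)) at_top)
       \<and> (\<forall>c::real. c > 0 \<and> 2 * c / real (card EL) \<le> 1 / (real (chromatic_number VL EL) - 1) \<longrightarrow>
           limsup (\<lambda>n. ereal (log 2 (real (M_L VL EL n (c * real n ^ card VL))) / real (n choose 2)))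
             \<le> ereal (1 / (real (chromatic_number VL EL) - 1) - 2 * c / real (card EL)))"
proof -
  define r where "r = chromatic_number VL EL - 1"
  have r: "chromatic_number VL EL = Suc r" and r1: "r \<ge> 1"
    using chromatic_number_ge_2[OF L nonempty] by (auto simp: r_def)
  then have rr: "0 < r" "r < chromatic_number VL EL" by auto
  have \<chi>: "real (chromatic_number VL EL) - 1 = real r" using r by simp
  show ?thesis
    unfolding \<chi>
  proof (intro conjI allI impI; (elim conjE)?)
    fix k :: "nat \<Rightarrow> nat"
    assume k1: "\<forall>n. k n \<ge> 1" and k: "(\<lambda>n. real (k n)) \<in> o(\<lambda>n. real n ^ card VL)"
    let ?a = "\<lambda>n. log 2 (real (M_L VL EL n (real (k n)))) / real (n choose 2)"
    \<comment> \<open>No limit is taken here: the Turan graph has no copy of L, hence fewer than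
      \<open>k n\<close>, and \<open>card_inner_edges\<close> is exact enough for each
      \<open>n\<close>.\<close>
    have upper: "\<forall>\<^sub>F n in sequentially. ?a n \<le> 1 / real r"
      using eventually_ge_at_top[of 2]
    proof eventually_elim
      case (elim n)
      let ?I = "inner_edges r n"
      have I: "?I \<subseteq> all_edges n" by (auto simp: inner_edges_def)
      have "k n > 0" using k1[rule_format, of n] by simp
      then have "log 2 (real (M_L VL EL n (real (k n)))) \<le> real ((n choose 2) - card (all_edges n - ?I))"
        by (intro log_M_L_upper[OF L]) (auto simp: num_copies_Turan[OF L rr])
      also have "(n choose 2) - card (all_edges n - ?I) = card ?I"
        using card_mono[OF finite_all_edges I] finite_subset[OF I finite_all_edges]
        by (simp add: card_Diff_subset[OF _ I] card_all_edges)
      finally have "real r * log 2 (real (M_L VL EL n (real (k n)))) \<le> real r * real (card ?I)"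
        by (intro mult_left_mono) auto
      also have "\<dots> \<le> real (n choose 2)"
        using card_inner_edges[of r n] unfolding of_nat_mult[symmetric] of_nat_le_iff .
      finally show ?case using r1 elim by (simp add: field_simps)
    qed
    have lower: "\<forall>\<^sub>F n in sequentially. l < ?a n" if l: "l < 1 / real r" for l
    proof -
      \<comment> \<open>Half of the gap: \<open>?s\<close> tends to 1/r - \<theta> = l + \<theta>,
        which still exceeds \<open>l\<close>.\<close>
      define \<theta> where "\<theta> = (1 / real r - l) / 2"
      have \<theta>: "\<theta> > 0" using l by (simp add: \<theta>_def)
      let ?s = "\<lambda>n. 1 - (1 - 1 / real r + \<theta>) * (real n ^ 2 / 2 / real (n choose 2))"
      have "?s \<longlonglongrightarrow> 1 - (1 - 1 / real r + \<theta>) * 1"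
        by (intro tendsto_intros choose_two_ratio)
      moreover have "l < 1 - (1 - 1 / real r + \<theta>) * 1" using l by (simp add: \<theta>_def field_simps)
      ultimately have "\<forall>\<^sub>F n in sequentially. l < ?s n" by (rule order_tendstoD(1))
      then show ?thesis
        using card_few_copies[OF L nonempty r k \<theta>] eventually_ge_at_top[of 2]
      proof eventually_elim
        case (elim n)
        let ?C = "real (n choose 2)" and ?b = "(1 - 1 / real r + \<theta>) * real n ^ 2 / 2"
        have C: "?C > 0" using elim(3) by simp
        have "?C - ?b \<le> log 2 (real (M_L VL EL n (real (k n))))"
          using log_M_L_lower[OF nonempty _ elim(2)] k1[rule_format, of n] by simp
        then have "(?C - ?b) / ?C \<le> ?a n" using C by (intro divide_right_mono) auto
        moreover have "(?C - ?b) / ?C = ?s n" using C by (simp add: field_simps)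
        ultimately show ?case using elim(1) by linarith
      qed
    qed
    show "?a \<longlonglongrightarrow> 1 / real r"
    proof (rule order_tendstoI)
      fix u assume "1 / real r < u"
      then show "\<forall>\<^sub>F n in sequentially. ?a n < u" using upper by (auto elim: eventually_mono)
    qed (rule lower)
  next
    fix c :: real
    assume c: "c > 0" "2 * c / real (card EL) \<le> 1 / real r"
    let ?d = "1 / real r - 2 * c / real (card EL)"
    let ?a = "\<lambda>n. log 2 (real (M_L VL EL n (c * real n ^ card VL))) / real (n choose 2)"
    have "\<forall>\<^sub>F n in sequentially. ereal (?a n) \<le> ereal (?d + 1 / real (n choose 2))"
      using eventually_ge_at_top[of 2]
    proof eventually_elim
      case (elim n)
      have "?a n \<le> (?d * real (n choose 2) + 1) / real (n choose 2)"
        using log_M_L_le_linear[OF L nonempty r c, of n] elim by (intro divide_right_mono) auto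
      also have "\<dots> = ?d + 1 / real (n choose 2)" using elim by (simp add: add_divide_distrib)
      finally show ?case by simp
    qed
    then have "limsup (\<lambda>n. ereal (?a n)) \<le> limsup (\<lambda>n. ereal (?d + 1 / real (n choose 2)))"
      by (rule Limsup_mono)
    also have "\<dots> = ereal (?d + 0)"
      by (intro lim_imp_Limsup tendsto_ereal tendsto_add tendsto_const inverse_choose_two) simp
    finally show "limsup (\<lambda>n. ereal (?a n)) \<le> ereal ?d" by simp
  qed
qed

end
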